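(* Let $A \in \mathbb{R}^{m \times n}$, $\vec b \in \mathbb{R}^n$, and let $\sigma_1$, $\sigma_n$ and $\sigma_m$ be the first, $n$-th and $m$-th singular value of $A$, respectively. Let $\bar{\vec y}_k = P_k f^\diamond(B_k) Q_k^T \vec b$, with $B_k = P_k^T A Q_k$, be the polynomial Krylov approximation to $\vec y = f^\diamond(A)\vec b$. Then $$\| f^\diamond(A) \vec b - \bar{\vec y}_k \|_2 \le 2 \|\vec b\|_2 \min_{p \in \Pi_{k-1}} \| f(z) - p(z^2) z \|_{\infty, [\sigma_n, \sigma_1]}.$$ Moreover, if $A$ is square with $\sigma_m = \sigma_n > 0$, or if $\lim_{z \to 0} \frac{f(z)}{z} = 0$, it also holds that $$\| f^\diamond(A) \vec b - \bar{\vec y}_k \|_2 \le 2 \|A \vec b\|_2 \min_{p \in \Pi_{k-1}} \| f(z)/z - p(z^2) \|_{\infty, [\sigma_{\max\{m,n\}}, \sigma_1]}.$$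
   Context: Generalized matrix function: let $A\in\mathbb{R}^{m\times n}$ have rank $r$ and compact SVD $A = U_r\Sigma_r V_r^T$, with $\Sigma_r=\mathrm{diag}(\sigma_1,\dots,\sigma_r)$, $\sigma_1\ge\dots\ge\sigma_r>0$, and $U_r\in\mathbb{R}^{m\times r}$, $V_r\in\mathbb{R}^{n\times r}$ with orthonormal columns. For $f$ defined on $\{\sigma_1,\dots,\sigma_r\}$, $f^\diamond(A) = U_r f(\Sigma_r)V_r^T$ with $f(\Sigma_r)=\mathrm{diag}(f(\sigma_1),\dots,f(\sigma_r))$. Since $f^\diamond(A)$ depends only on values of $f$ at the nonzero singular values, $f$ is by convention taken to satisfy $f(0)=0$. Singular values: listed in nonincreasing order $\sigma_1\ge\dots\ge\sigma_{\min\{m,n\}}\ge 0$, with the convention $\sigma_j := 0$ for $\min\{m,n\}<j\le\max\{m,n\}$. $\Pi_{k-1}$ is the set of polynomials of degree $\le k-1$, and $\|h\|_{\infty,I}=\sup_{z\in I}|h(z)|$. The function $f$ is real-valued and defined on the interval appearing in the respective bound. When $\lim_{z\to0}f(z)/z=0$, the value of $f(z)/z$ at $z=0$ is taken to be $0$. Polynomial Krylov approximation: $\mathcal{P}_k(M,\vec c)=\mathrm{span}\{\vec c, M\vec c,\dots,M^{k-1}\vec c\}$. The matrices $Q_k\in\mathbb{R}^{n\times k}$ and $P_k\in\mathbb{R}^{m\times k}$ have orthonormal columns forming bases of $\mathcal{P}_k(A^TA,\vec b)$ and $\mathcal{P}_k(AA^T,A\vec b)$ respectively (both assumed to have dimension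 $k$); they are the matrices computed by the Golub-Kahan bidiagonalization with starting vector $\vec b$. *)

theory Defs
  imports
    "Jordan_Normal_Form.DL_Rank"
    "HOL-Library.Extended_Nonnegative_Real"
begin

text \<open>Positivity of the entries of \<open>s\<close> together with the orthonormality of the columns of
  \<open>U\<close> and \<open>V\<close> forces \<open>length s\<close> to be the rank of \<open>A\<close>. The case \<open>s = []\<close> is the zero matrix.\<close>

definition is_compact_svd :: "real mat \<Rightarrow> real mat \<Rightarrow> real list \<Rightarrow> real mat \<Rightarrow> bool" where
  "is_compact_svd A U s V \<longleftrightarrow>
     U \<in> carrier_mat (dim_row A) (length s) \<and>
     V \<in> carrier_mat (dim_col A) (length s) \<and>
     U\<^sup>T * U = 1\<^sub>m (length s) \<and>
     V\<^sup>T * V = 1\<^sub>m (length s) \<and>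
     sorted_wrt (\<ge>) s \<and> (\<forall>x\<in>set s. x > 0) \<and>
     A = U * mat_diag (length s) (\<lambda>i. s ! i) * V\<^sup>T"

text \<open>Every real matrix has a compact SVD; it is not unique, but neither the singular values
  nor the generalized matrix function below depend on the choice made here.\<close>

definition compact_svd :: "real mat \<Rightarrow> real mat \<times> real list \<times> real mat" where
  "compact_svd A = (SOME (U, s, V). is_compact_svd A U s V)"

text \<open>Numbered from 1, in nonincreasing order. All values beyond the rank are 0; this includes the
  convention that the values numbered between the smaller and the larger dimension are 0.\<close>

definition singular_value :: "real mat \<Rightarrow> nat \<Rightarrow> real" where
  "singular_value A j =
     (case compact_svd A of (U, s, V) \<Rightarrow> if 1 \<le> j \<and> j \<le> length s then s ! (j - 1) else 0)"

definition gen_mat_fun :: "(real \<Rightarrow> real) \<Rightarrow> real mat \<Rightarrow> real mat" where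
  "gen_mat_fun f A =
     (case compact_svd A of (U, s, V) \<Rightarrow> U * mat_diag (length s) (\<lambda>i. f (s ! i)) * V\<^sup>T)"

definition vec_norm2 :: "real vec \<Rightarrow> real" where
  "vec_norm2 v = sqrt (v \<bullet> v)"

definition krylov :: "nat \<Rightarrow> real mat \<Rightarrow> real vec \<Rightarrow> real vec set" where
  "krylov k M c = LinearCombinations.module.span class_ring (module_vec TYPE(real) (dim_vec c))
     {(M ^\<^sub>m i) *\<^sub>v c | i. i < k}"

text \<open>The \<open>k\<close> columns of \<open>Q\<close> are an orthonormal basis of the subspace \<open>W\<close> of \<open>\<real>\<^sup>d\<close>; in particular
  \<open>W\<close> then has dimension \<open>k\<close>.\<close>

definition orthonormal_basis_matrix :: "nat \<Rightarrow> nat \<Rightarrow> real mat \<Rightarrow> real vec set \<Rightarrow> bool" where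
  "orthonormal_basis_matrix d k Q W \<longleftrightarrow>
     Q \<in> carrier_mat d k \<and> Q\<^sup>T * Q = 1\<^sub>m k \<and> vec_space.col_space d Q = W"

text \<open>For a Golub-Kahan pair \<open>P\<close>, \<open>Q\<close>. The result does not change when the columns of \<open>P\<close> and \<open>Q\<close>
  are replaced by other orthonormal bases of the same subspaces.\<close>

definition krylov_approx ::
  "(real \<Rightarrow> real) \<Rightarrow> real mat \<Rightarrow> real vec \<Rightarrow> real mat \<Rightarrow> real mat \<Rightarrow> real vec" where
  "krylov_approx f A b P Q = P *\<^sub>v (gen_mat_fun f (P\<^sup>T * A * Q) *\<^sub>v (Q\<^sup>T *\<^sub>v b))"

text \<open>Extended-valued, since \<open>h\<close> need not be bounded on \<open>I\<close>.\<close>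

definition sup_norm :: "real set \<Rightarrow> (real \<Rightarrow> real) \<Rightarrow> ennreal" where
  "sup_norm I h = (SUP z\<in>I. ennreal \<bar>h z\<bar>)"

text \<open>The value \<open>\<mu>\<close> is the (attained) minimum of \<open>E\<close> over the polynomials of degree at most \<open>d\<close>.\<close>

definition is_poly_min :: "nat \<Rightarrow> (real poly \<Rightarrow> ennreal) \<Rightarrow> ennreal \<Rightarrow> bool" where
  "is_poly_min d E \<mu> \<longleftrightarrow> (\<exists>p. is_arg_min E (\<lambda>p. degree p \<le> d) p \<and> \<mu> = E p)"

end

theory Submission
  imports Defs "HOL-Analysis.Function_Topology" "HOL-Analysis.L2_Norm"
begin

text \<open>The Krylov approximation is exact for odd polynomials \<open>q z = p (z\<^sup>2) * z\<close> with \<open>p\<close> of degree below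
  \<open>k\<close>: \<open>B\<^sup>T B\<close> is the compression of \<open>A\<^sup>T A\<close> to the Krylov space, so the monomials of \<open>q\<close> are reproduced.
  Hence the error for \<open>f\<close> equals the error for \<open>e = f - q\<close>, a difference of two vectors that are
  each bounded by the maximum of \<open>e\<close> on the nonzero singular values of \<open>A\<close> and of \<open>B\<close>. Since
  \<open>\<parallel>B x\<parallel> = \<parallel>A (Q x)\<parallel>\<close>, the singular values of \<open>B\<close> lie between the extreme ones of \<open>A\<close>. For the second
  bound a factor \<open>z\<close> is split off \<open>e\<close> and spent on turning \<open>b\<close> into \<open>A b\<close>. As the definitions select an SVD and ask
  for an attained minimum, existence of both has to be shown; either is a compactness argument
  in the product topology on \<open>nat \<Rightarrow> real\<close>.\<close>

section \<open>Euclidean norm and orthonormal columns\<close>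

lemma vec_norm2_eq_L2_set: "vec_norm2 v = L2_set (($) v) {..<dim_vec v}"
  by (simp add: vec_norm2_def L2_set_def scalar_prod_def power2_eq_square atLeast0LessThan)

lemma vec_norm2_nonneg [simp]: "0 \<le> vec_norm2 v"
  by (simp add: vec_norm2_eq_L2_set)

lemma vec_norm2_power2: "(vec_norm2 v)\<^sup>2 = v \<bullet> v"
  unfolding vec_norm2_def by (rule real_sqrt_pow2) (simp add: scalar_prod_def sum_nonneg)

lemma vec_norm2_triangle_minus:
  assumes "v \<in> carrier_vec d" "w \<in> carrier_vec d"
  shows "vec_norm2 (v - w) \<le> vec_norm2 v + vec_norm2 w"
proof -
  have "vec_norm2 (v - w) = L2_set (\<lambda>i. v $ i + - (w $ i)) {..<d}"
    using assms by (auto simp: vec_norm2_eq_L2_set intro!: L2_set_cong)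
  also have "\<dots> \<le> L2_set (($) v) {..<d} + L2_set (\<lambda>i. - (w $ i)) {..<d}"
    by (rule L2_set_triangle_ineq)
  also have "\<dots> = vec_norm2 v + vec_norm2 w"
    using assms by (simp add: vec_norm2_eq_L2_set L2_set_def)
  finally show ?thesis .
qed

lemma scalar_prod_le_vec_norm2:
  assumes "v \<in> carrier_vec d" "w \<in> carrier_vec d"
  shows "v \<bullet> w \<le> vec_norm2 v * vec_norm2 w"
proof -
  have "v \<bullet> w \<le> (\<Sum>i<d. \<bar>v $ i\<bar> * \<bar>w $ i\<bar>)"
    using assms by (auto simp: scalar_prod_def atLeast0LessThan abs_mult[symmetric] intro!: sum_mono)
  also have "\<dots> \<le> L2_set (($) v) {..<d} * L2_set (($) w) {..<d}"
    by (rule L2_set_mult_ineq)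
  finally show ?thesis using assms by (simp add: vec_norm2_eq_L2_set)
qed

lemma vec_norm2_smult: "vec_norm2 (c \<cdot>\<^sub>v v) = \<bar>c\<bar> * vec_norm2 v"
  by (simp add: vec_norm2_eq_L2_set L2_set_def power_mult_distrib sum_distrib_left[symmetric] real_sqrt_mult)

lemma vec_norm2_eq_0_imp:
  assumes "vec_norm2 v = 0" "v \<in> carrier_vec d"
  shows "v = 0\<^sub>v d"
  using assms by (auto simp: vec_norm2_eq_L2_set L2_set_eq_0_iff)

lemma transpose_mult_mat_vec_scalar_prod:
  fixes M :: "real mat"
  assumes "M \<in> carrier_mat d k" "x \<in> carrier_vec k" "y \<in> carrier_vec d"
  shows "y \<bullet> (M *\<^sub>v x) = (M\<^sup>T *\<^sub>v y) \<bullet> x"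
  using assms by (metis transpose_vec_mult_scalar comm_scalar_prod mult_mat_vec_carrier transpose_carrier_mat)

lemma orthonormal_cols_mult_vec:
  fixes Q :: "real mat"
  assumes "Q \<in> carrier_mat d k" "Q\<^sup>T * Q = 1\<^sub>m k" "x \<in> carrier_vec k"
  shows "Q\<^sup>T *\<^sub>v (Q *\<^sub>v x) = x"
  using assms by (metis assoc_mult_mat_vec one_mult_mat_vec transpose_carrier_mat)

lemma vec_norm2_orthonormal_cols:
  assumes Q: "Q \<in> carrier_mat d k" "Q\<^sup>T * Q = 1\<^sub>m k" and x: "x \<in> carrier_vec k"
  shows "vec_norm2 (Q *\<^sub>v x) = vec_norm2 x"
proof -
  have "(Q *\<^sub>v x) \<bullet> (Q *\<^sub>v x) = x \<bullet> x"
    using transpose_mult_mat_vec_scalar_prod[OF Q(1) x, of "Q *\<^sub>v x"] Q x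
    by (simp add: orthonormal_cols_mult_vec)
  then show ?thesis by (simp add: vec_norm2_def)
qed

text \<open>Bessel's inequality: |Q^T v|^2 = v . (Q Q^T v), and Cauchy-Schwarz with the isometry Q
  bounds this by |v| |Q^T v|. Dividing requires setting aside the case of norm 0.\<close>

lemma vec_norm2_transpose_orthonormal_cols:
  assumes Q: "Q \<in> carrier_mat d k" "Q\<^sup>T * Q = 1\<^sub>m k" and v: "v \<in> carrier_vec d"
  shows "vec_norm2 (Q\<^sup>T *\<^sub>v v) \<le> vec_norm2 v"
proof -
  let ?w = "Q\<^sup>T *\<^sub>v v"
  have w: "?w \<in> carrier_vec k" using Q v by auto
  have "(vec_norm2 ?w)\<^sup>2 = v \<bullet> (Q *\<^sub>v ?w)"
    using transpose_mult_mat_vec_scalar_prod[OF Q(1) w v] by (simp add: vec_norm2_power2)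
  also have "\<dots> \<le> vec_norm2 v * vec_norm2 ?w"
    using scalar_prod_le_vec_norm2[OF v, of "Q *\<^sub>v ?w"] Q w by (simp add: vec_norm2_orthonormal_cols)
  finally show ?thesis
    using vec_norm2_nonneg[of ?w] vec_norm2_nonneg[of v]
    by (cases "vec_norm2 ?w = 0") (simp_all add: power2_eq_square)
qed

text \<open>The sum of all squared entries is k when taken by columns. By rows it is at most d,
  since row i is Q^T applied to the i-th unit vector and so has norm at most 1.\<close>

lemma orthonormal_cols_le:
  fixes Q :: "real mat"
  assumes Q: "Q \<in> carrier_mat d k" "Q\<^sup>T * Q = 1\<^sub>m k"
  shows "k \<le> d"
proof -
  have row: "row Q i \<bullet> row Q i \<le> 1" if "i < d" for i
  proof -
    have "row Q i = Q\<^sup>T *\<^sub>v unit_vec d i" using Q that by (auto simp: mult_mat_vec_def)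
    then have "vec_norm2 (row Q i) \<le> vec_norm2 (unit_vec d i)"
      using vec_norm2_transpose_orthonormal_cols[OF Q, of "unit_vec d i"] by simp
    also have "\<dots> = 1" using that by (simp add: vec_norm2_def)
    finally show ?thesis by (simp add: vec_norm2_power2[symmetric] power_le_one)
  qed
  have "real k = (\<Sum>j<k. (Q\<^sup>T * Q) $$ (j,j))" by (simp add: Q)
  also have "\<dots> = (\<Sum>j<k. \<Sum>i<d. Q $$ (i,j) * Q $$ (i,j))"
    using Q(1) by (auto simp: scalar_prod_def atLeast0LessThan)
  also have "\<dots> = (\<Sum>i<d. row Q i \<bullet> row Q i)"
    using Q(1) by (subst sum.swap) (auto simp: scalar_prod_def atLeast0LessThan)
  also have "\<dots> \<le> (\<Sum>i<d. 1)" by (rule sum_mono) (use row in auto)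
  finally show ?thesis by simp
qed

section \<open>Existence of a compact SVD\<close>

text \<open>Coordinates from k on are pinned to 0, so tuples of every length live in the one space
  \<open>nat \<Rightarrow> real\<close>, where Tychonoff's theorem makes the box compact.\<close>

lemma compact_box:
  fixes c :: "nat \<Rightarrow> real"
  shows "compact (PiE UNIV (\<lambda>i. if i < k then {- c i..c i} else {0}))"
proof -
  have "compactin (product_topology (\<lambda>i::nat. euclidean) UNIV) (PiE UNIV (\<lambda>i. if i < k then {- c i..c i} else {0}))"
    unfolding compactin_PiE compactin_euclidean_iff by (simp split: if_split)
  then show ?thesis unfolding euclidean_product_topology compactin_euclidean_iff .
qed

lemma continuous_on_coordinate: "continuous_on S (\<lambda>x::nat \<Rightarrow> real. x i)"
  by (rule continuous_on_subset[OF continuous_on_product_coordinates subset_UNIV])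

text \<open>A continuous function attains its maximum on the unit sphere, a closed part of a box;
  scaling extends the estimate from unit vectors to all x. The maximum is the spectral norm of
  A.\<close>

lemma ex_unit_vec_maximizing:
  fixes A :: "real mat"
  assumes A: "A \<in> carrier_mat m n" and nz: "A \<noteq> 0\<^sub>m m n"
  obtains v where "v \<in> carrier_vec n" "v \<bullet> v = 1" "vec_norm2 (A *\<^sub>v v) > 0"
    "\<And>x. x \<in> carrier_vec n \<Longrightarrow> vec_norm2 (A *\<^sub>v x) \<le> vec_norm2 (A *\<^sub>v v) * vec_norm2 x"
proof -
  define K where "K = PiE UNIV (\<lambda>i. if i < n then {-1..1::real} else {0}) \<inter> {x. (\<Sum>i<n. x i * x i) = 1}"
  define F where "F x = (\<Sum>i<m. (\<Sum>j<n. A $$ (i,j) * x j)\<^sup>2)" for x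
  have "compact K" unfolding K_def
    by (intro compact_Int_closed compact_box closed_Collect_eq continuous_intros continuous_on_coordinate)
  moreover have contF: "continuous_on K F" unfolding F_def
    by (intro continuous_intros continuous_on_coordinate)
  moreover from nz A obtain i j where ij: "i < m" "j < n" "A $$ (i,j) \<noteq> 0"
    by (metis eq_matI carrier_matD index_zero_mat zero_carrier_mat)
  \<comment> \<open>The j-th unit vector, for a column j with a nonzero entry: it shows here that
    \<open>K\<close> is nonempty and below that the maximum is positive.\<close>
  have unitK: "(\<lambda>l. if l = j then 1 else 0) \<in> K"
    using ij by (auto simp: K_def PiE_def Pi_def extensional_def if_distrib cong: if_cong)
  ultimately obtain xm where xm: "xm \<in> K" "\<And>x. x \<in> K \<Longrightarrow> F x \<le> F xm"
    using continuous_attains_sup[of K F] by blast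
  have F: "F (\<lambda>i. if i < n then x $ i else 0) = (vec_norm2 (A *\<^sub>v x))\<^sup>2"
    if "x \<in> carrier_vec n" for x
    using that A unfolding vec_norm2_power2 F_def
    by (simp add: scalar_prod_def atLeast0LessThan power2_eq_square)
  define v where "v = vec n xm"
  have v: "v \<in> carrier_vec n" by (simp add: v_def)
  have xm_v: "xm = (\<lambda>i. if i < n then v $ i else 0)"
    using xm(1) by (auto simp: K_def v_def PiE_def Pi_def fun_eq_iff split: if_splits)
  have Fv: "F xm = (vec_norm2 (A *\<^sub>v v))\<^sup>2" using F[OF v] xm_v by simp
  have "v \<bullet> v = 1" using xm(1) by (simp add: K_def v_def scalar_prod_def atLeast0LessThan)
  have max: "vec_norm2 (A *\<^sub>v x) \<le> vec_norm2 (A *\<^sub>v v) * vec_norm2 x" if x: "x \<in> carrier_vec n" for x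
  proof (cases "vec_norm2 x = 0")
    case True
    then have "x = 0\<^sub>v n" using vec_norm2_eq_0_imp x by blast
    moreover have "A *\<^sub>v 0\<^sub>v n = 0\<^sub>v m" using A by auto
    ultimately show ?thesis by (simp add: vec_norm2_def)
  next
    case False
    define y where "y = (1 / vec_norm2 x) \<cdot>\<^sub>v x"
    have y: "y \<in> carrier_vec n" using x by (simp add: y_def)
    have "vec_norm2 y = 1" using False by (simp add: y_def vec_norm2_smult)
    then have yy: "y \<bullet> y = 1" using vec_norm2_power2[of y] by simp
    have "(y $ i)\<^sup>2 \<le> 1" if "i < n" for i
      using member_le_sum[of i "{..<n}" "\<lambda>i. y $ i * y $ i"] that yy y
      by (simp add: scalar_prod_def atLeast0LessThan power2_eq_square)
    then have "-1 \<le> y $ i \<and> y $ i \<le> 1" if "i < n" for i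
      using that abs_square_le_1[of "y $ i"] by (simp add: abs_le_iff)
    then have "(\<lambda>i. if i < n then y $ i else 0) \<in> K"
      using yy y by (auto simp: K_def PiE_def Pi_def extensional_def scalar_prod_def atLeast0LessThan)
    from xm(2)[OF this] have "(vec_norm2 (A *\<^sub>v y))\<^sup>2 \<le> (vec_norm2 (A *\<^sub>v v))\<^sup>2"
      by (simp only: Fv F[OF y])
    then have "vec_norm2 (A *\<^sub>v y) \<le> vec_norm2 (A *\<^sub>v v)"
      by (simp add: power2_le_iff_abs_le)
    moreover have "A *\<^sub>v y = (1 / vec_norm2 x) \<cdot>\<^sub>v (A *\<^sub>v x)"
      using A x by (simp add: y_def mult_mat_vec)
    ultimately show ?thesis using False vec_norm2_nonneg[of x]
      by (simp add: vec_norm2_smult field_simps)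
  qed
  have "0 < (A $$ (i,j))\<^sup>2" using ij by simp
  also have "\<dots> \<le> F (\<lambda>l. if l = j then 1 else 0)"
    using member_le_sum[of i "{..<m}" "\<lambda>i. (A $$ (i,j))\<^sup>2"] ij by (simp add: F_def if_distrib cong: if_cong)
  also have "\<dots> \<le> F xm" using xm(2) unitK by blast
  finally have "vec_norm2 (A *\<^sub>v v) > 0" using Fv vec_norm2_nonneg[of "A *\<^sub>v v"] by (simp add: le_less)
  with v \<open>v \<bullet> v = 1\<close> max show thesis using that by blast
qed

text \<open>Equality in Cauchy-Schwarz: w = A^T u has norm at most \<sigma>, while w . v = \<sigma>
  and |v| = 1. Then |w - \<sigma> v|^2 = |w|^2 - \<sigma>^2 is at most 0, so w = \<sigma> v.\<close>

lemma transpose_mult_maximizing_vec: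
  fixes A :: "real mat"
  assumes A: "A \<in> carrier_mat m n" and v: "v \<in> carrier_vec n" "v \<bullet> v = 1"
    and pos: "vec_norm2 (A *\<^sub>v v) = \<sigma>" "\<sigma> > 0"
    and max: "\<And>x. x \<in> carrier_vec n \<Longrightarrow> vec_norm2 (A *\<^sub>v x) \<le> \<sigma> * vec_norm2 x"
    and u: "u = (1 / \<sigma>) \<cdot>\<^sub>v (A *\<^sub>v v)"
  shows "A\<^sup>T *\<^sub>v u = \<sigma> \<cdot>\<^sub>v v"
proof -
  define w where "w = A\<^sup>T *\<^sub>v u"
  have uc: "u \<in> carrier_vec m" using A v u by simp
  have w: "w \<in> carrier_vec n" using A uc by (simp add: w_def)
  have nu: "vec_norm2 u = 1" using pos by (simp add: u vec_norm2_smult)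
  have Avu: "A *\<^sub>v v = \<sigma> \<cdot>\<^sub>v u" using pos by (simp add: u smult_smult_assoc)
  have "w \<bullet> v = u \<bullet> (A *\<^sub>v v)"
    using transpose_mult_mat_vec_scalar_prod[OF A v(1) uc] by (simp add: w_def)
  also have "\<dots> = \<sigma>" using uc nu by (simp add: Avu vec_norm2_power2[symmetric])
  finally have wv: "w \<bullet> v = \<sigma>" .
  \<comment> \<open>Pairing w with itself moves A^T over to A w, where the maximality of \<sigma>
    applies.\<close>
  have "w \<bullet> w = u \<bullet> (A *\<^sub>v w)"
    using transpose_mult_mat_vec_scalar_prod[OF A w uc] by (simp add: w_def)
  also have "\<dots> \<le> vec_norm2 u * vec_norm2 (A *\<^sub>v w)"
    by (rule scalar_prod_le_vec_norm2[OF uc]) (use A w in auto)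
  also have "\<dots> \<le> \<sigma> * vec_norm2 w" using max[OF w] nu by simp
  finally have "vec_norm2 w \<le> \<sigma>" using pos vec_norm2_nonneg[of w]
    by (cases "vec_norm2 w = 0") (simp_all add: vec_norm2_power2[symmetric] power2_eq_square)
  then have ww: "w \<bullet> w \<le> \<sigma>\<^sup>2" by (simp add: vec_norm2_power2[symmetric] power_mono)
  have vw: "v \<bullet> w = \<sigma>" using wv comm_scalar_prod[OF v(1) w] by simp
  have "(vec_norm2 (w - \<sigma> \<cdot>\<^sub>v v))\<^sup>2 = w \<bullet> w - \<sigma>\<^sup>2"
    using w v unfolding vec_norm2_power2
    by (simp add: minus_scalar_prod_distrib[of _ n] scalar_prod_minus_distrib[of _ n]
        wv vw power2_eq_square algebra_simps)
  with ww have "(vec_norm2 (w - \<sigma> \<cdot>\<^sub>v v))\<^sup>2 \<le> 0" by simp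
  then have "vec_norm2 (w - \<sigma> \<cdot>\<^sub>v v) = 0" by simp
  then have "w - \<sigma> \<cdot>\<^sub>v v = 0\<^sub>v n" using vec_norm2_eq_0_imp w v by (metis minus_carrier_vec smult_carrier_vec)
  then have "(w - \<sigma> \<cdot>\<^sub>v v) $ i = 0" if "i < n" for i
    using that by simp
  then show ?thesis using w v unfolding w_def[symmetric] by auto
qed

text \<open>Lists rather than matrices, because the deflation below prepends one vector at a time;
  \<open>mat_of_cols\<close> turns the finished lists into the factors of the SVD.\<close>

definition orthonormal_list :: "nat \<Rightarrow> real vec list \<Rightarrow> bool" where
  "orthonormal_list d vs \<longleftrightarrow> set vs \<subseteq> carrier_vec d \<and>
     (\<forall>i<length vs. \<forall>j<length vs. vs ! i \<bullet> vs ! j = (if i = j then 1 else 0))"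

lemma orthonormal_list_Nil [simp]: "orthonormal_list d []"
  by (simp add: orthonormal_list_def)

lemma orthonormal_list_Cons:
  assumes vs: "orthonormal_list d vs" and v: "v \<in> carrier_vec d" "v \<bullet> v = 1"
    and orth: "\<And>i. i < length vs \<Longrightarrow> v \<bullet> vs ! i = 0"
  shows "orthonormal_list d (v # vs)"
proof -
  have "vs ! i \<bullet> v = 0" if "i < length vs" for i
    using that orth[OF that] vs v comm_scalar_prod[of v d "vs ! i"]
    by (auto simp: orthonormal_list_def subset_iff)
  with assms show ?thesis
    by (auto simp: orthonormal_list_def nth_Cons split: nat.splits)
qed

lemma orthonormal_list_mat_of_cols:
  assumes "orthonormal_list d vs"
  shows "(mat_of_cols d vs)\<^sup>T * mat_of_cols d vs = 1\<^sub>m (length vs)"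
  using assms by (intro eq_matI) (auto simp: orthonormal_list_def subset_iff)

lemma orthonormal_list_length_le: "orthonormal_list d vs \<Longrightarrow> length vs \<le> d"
  by (rule orthonormal_cols_le[OF _ orthonormal_list_mat_of_cols]) auto

lemma rank_one_update_mult_vec:
  fixes A :: "real mat"
  assumes "A \<in> carrier_mat m n" "u \<in> carrier_vec m" "v \<in> carrier_vec n" "x \<in> carrier_vec n"
  shows "mat m n (\<lambda>(i,j). A $$ (i,j) - c * u $ i * v $ j) *\<^sub>v x = A *\<^sub>v x - (c * (v \<bullet> x)) \<cdot>\<^sub>v u"
  using assms by (intro eq_vecI)
    (auto simp: scalar_prod_def sum_subtractf sum_distrib_left sum_distrib_right algebra_simps)

text \<open>The induction deflates \<open>A\<close> by its leading singular triple; \<open>ws\<close> collects the right singular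
  vectors already split off, and its length is what makes the recursion end.\<close>

lemma ex_singular_triples:
  fixes A :: "real mat"
  assumes "A \<in> carrier_mat m n" "orthonormal_list n ws" "\<And>w. w \<in> set ws \<Longrightarrow> A *\<^sub>v w = 0\<^sub>v m"
  shows "\<exists>us s vs. length us = length s \<and> length vs = length s \<and>
     orthonormal_list m us \<and> orthonormal_list n vs \<and> sorted_wrt (\<ge>) s \<and> (\<forall>x\<in>set s. x > 0) \<and>
     (\<forall>i<length s. A *\<^sub>v vs ! i = s ! i \<cdot>\<^sub>v us ! i \<and> A\<^sup>T *\<^sub>v us ! i = s ! i \<cdot>\<^sub>v vs ! i) \<and>
     A = mat m n (\<lambda>(i,j). \<Sum>l<length s. s ! l * us ! l $ i * vs ! l $ j)"
  using assms
proof (induction "n - length ws" arbitrary: A ws rule: less_induct)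
  case less
  note A = less.prems(1) and ws = less.prems(2,3)
  show ?case
  proof (cases "A = 0\<^sub>m m n")
    case True
    then show ?thesis by (intro exI[of _ "[]"]) (auto intro!: eq_matI)
  next
    case False
    from ex_unit_vec_maximizing[OF A False] obtain v where v: "v \<in> carrier_vec n" "v \<bullet> v = 1"
      and pos: "vec_norm2 (A *\<^sub>v v) > 0"
      and max: "\<And>x. x \<in> carrier_vec n \<Longrightarrow> vec_norm2 (A *\<^sub>v x) \<le> vec_norm2 (A *\<^sub>v v) * vec_norm2 x"
      by blast
    define \<sigma> where "\<sigma> = vec_norm2 (A *\<^sub>v v)"
    define u where "u = (1 / \<sigma>) \<cdot>\<^sub>v (A *\<^sub>v v)"
    have \<sigma>: "\<sigma> > 0" using pos by (simp add: \<sigma>_def)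
    have u: "u \<in> carrier_vec m" using A v by (simp add: u_def)
    have "vec_norm2 u = 1" using \<sigma> by (simp add: u_def vec_norm2_smult \<sigma>_def)
    then have uu: "u \<bullet> u = 1" using vec_norm2_power2[of u] by simp
    have Av: "A *\<^sub>v v = \<sigma> \<cdot>\<^sub>v u" using \<sigma> by (simp add: u_def smult_smult_assoc)
    have Au: "A\<^sup>T *\<^sub>v u = \<sigma> \<cdot>\<^sub>v v"
      by (rule transpose_mult_maximizing_vec[OF A v \<sigma>_def[symmetric] \<sigma> _ u_def])
        (use max in \<open>simp add: \<sigma>_def\<close>)
    have AT: "A\<^sup>T \<in> carrier_mat n m" using A by simp
    define A' where "A' = mat m n (\<lambda>(i,j). A $$ (i,j) - \<sigma> * u $ i * v $ j)"
    have A': "A' \<in> carrier_mat m n" by (simp add: A'_def)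
    have A'x: "A' *\<^sub>v x = A *\<^sub>v x - (\<sigma> * (v \<bullet> x)) \<cdot>\<^sub>v u" if "x \<in> carrier_vec n" for x
      unfolding A'_def by (rule rank_one_update_mult_vec[OF A u v(1) that])
    have "A'\<^sup>T = mat n m (\<lambda>(i,j). A\<^sup>T $$ (i,j) - \<sigma> * v $ i * u $ j)"
      using A by (auto simp: A'_def intro!: eq_matI)
    then have A'Ty: "A'\<^sup>T *\<^sub>v y = A\<^sup>T *\<^sub>v y - (\<sigma> * (u \<bullet> y)) \<cdot>\<^sub>v v" if "y \<in> carrier_vec m" for y
      using rank_one_update_mult_vec[OF AT v(1) u that] by simp
    have A'v: "A' *\<^sub>v v = 0\<^sub>v m" using A'x[OF v(1)] v u by (simp add: Av)
    have A'u: "A'\<^sup>T *\<^sub>v u = 0\<^sub>v n" using A'Ty[OF u] v u uu by (simp add: Au)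
    \<comment> \<open>\<sigma> v = A^T u lies in the range of A^T, which is orthogonal to the kernel
      of A, and \<open>ws\<close> lies in that kernel.\<close>
    have vw: "v \<bullet> w = 0" if "w \<in> set ws" for w
    proof -
      have w: "w \<in> carrier_vec n" using that ws by (auto simp: orthonormal_list_def)
      have "\<sigma> * (v \<bullet> w) = (A\<^sup>T *\<^sub>v u) \<bullet> w" using v w by (simp add: Au)
      also have "\<dots> = u \<bullet> (A *\<^sub>v w)"
        using transpose_mult_mat_vec_scalar_prod[OF A w u] by simp
      also have "\<dots> = 0" using ws(2)[OF that] u by simp
      finally show ?thesis using \<sigma> by simp
    qed
    have ws': "orthonormal_list n (v # ws)"
      by (rule orthonormal_list_Cons[OF ws(1) v]) (use vw in auto)
    have kill: "A' *\<^sub>v w = 0\<^sub>v m" if "w \<in> set (v # ws)" for w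
    proof (cases "w = v")
      case False
      then have w: "w \<in> set ws" "w \<in> carrier_vec n" using that ws by (auto simp: orthonormal_list_def)
      then show ?thesis using A'x[of w] ws(2)[of w] vw[of w] u by auto
    qed (use A'v in simp)
    \<comment> \<open>The longer list is still orthonormal, so it has at most n entries; this makes
      the truncated difference drop strictly.\<close>
    have "n - length (v # ws) < n - length ws"
      using orthonormal_list_length_le[OF ws'] by simp
    from less.hyps[OF this A' ws' kill] obtain us s vs where
      len: "length us = length s" "length vs = length s"
      and us: "orthonormal_list m us" and vs: "orthonormal_list n vs"
      and s: "sorted_wrt (\<ge>) s" "\<forall>x\<in>set s. x > 0"
      and sv: "\<And>i. i < length s \<Longrightarrow> A' *\<^sub>v vs ! i = s ! i \<cdot>\<^sub>v us ! i"
        "\<And>i. i < length s \<Longrightarrow> A'\<^sup>T *\<^sub>v us ! i = s ! i \<cdot>\<^sub>v vs ! i"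
      and A'_eq: "A' = mat m n (\<lambda>(i,j). \<Sum>l<length s. s ! l * us ! l $ i * vs ! l $ j)"
      by auto
    have usi: "us ! i \<in> carrier_vec m" and vsi: "vs ! i \<in> carrier_vec n"
      and nvs: "vs ! i \<bullet> vs ! i = 1" and nus: "us ! i \<bullet> us ! i = 1" and spos: "s ! i > 0"
      if "i < length s" for i
      using that us vs len s by (auto simp: orthonormal_list_def subset_iff)
    \<comment> \<open>The same orthogonality for \<open>A'\<close>: its right singular vectors lie
      in the range of its transpose, and v lies in its kernel.\<close>
    have v_vs: "v \<bullet> vs ! i = 0" if "i < length s" for i
    proof -
      have "s ! i * (v \<bullet> vs ! i) = v \<bullet> (A'\<^sup>T *\<^sub>v us ! i)" using sv(2)[OF that] v vsi[OF that] by simp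
      also have "\<dots> = (A' *\<^sub>v v) \<bullet> us ! i"
        using transpose_mult_mat_vec_scalar_prod[of "A'\<^sup>T" n m "us ! i" v] A' v usi[OF that] by simp
      also have "\<dots> = 0" using usi[OF that] by (simp add: A'v)
      finally show ?thesis using spos[OF that] by simp
    qed
    have u_us: "u \<bullet> us ! i = 0" if "i < length s" for i
    proof -
      have "s ! i * (u \<bullet> us ! i) = u \<bullet> (A' *\<^sub>v vs ! i)" using sv(1)[OF that] u usi[OF that] by simp
      also have "\<dots> = (A'\<^sup>T *\<^sub>v u) \<bullet> vs ! i"
        using transpose_mult_mat_vec_scalar_prod[OF A' vsi[OF that] u] by simp
      also have "\<dots> = 0" using vsi[OF that] by (simp add: A'u)
      finally show ?thesis using spos[OF that] by simp
    qed
    \<comment> \<open>On vectors orthogonal to v (for the transpose: to u) the deflated matrix acts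
      like A, so its triples are triples of A.\<close>
    have A_vs: "A *\<^sub>v vs ! i = s ! i \<cdot>\<^sub>v us ! i" if "i < length s" for i
      using A'x[OF vsi[OF that]] sv(1)[OF that] v_vs[OF that] A u
      by (auto simp: vec_eq_iff)
    have A_us: "A\<^sup>T *\<^sub>v us ! i = s ! i \<cdot>\<^sub>v vs ! i" if "i < length s" for i
      using A'Ty[OF usi[OF that]] sv(2)[OF that] u_us[OF that] A v
      by (auto simp: vec_eq_iff)
    \<comment> \<open>The maximality of \<sigma> is applied to the unit vector
      \<open>vs ! i\<close>, whose image under A has norm \<open>s ! i\<close>. Hence the list stays
      nonincreasing with \<sigma> in front.\<close>
    have "s ! i \<le> \<sigma>" if "i < length s" for i
    proof -
      have "vec_norm2 (us ! i) = 1" "vec_norm2 (vs ! i) = 1"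
        using nus[OF that] nvs[OF that] by (simp_all add: vec_norm2_def)
      then show ?thesis
        using max[OF vsi[OF that]] spos[OF that]
        by (simp add: A_vs[OF that] vec_norm2_smult \<sigma>_def[symmetric])
    qed
    then have "\<forall>x\<in>set s. x \<le> \<sigma>" by (auto simp: in_set_conv_nth)
    then have sorted: "sorted_wrt (\<ge>) (\<sigma> # s)" using s by simp
    have "A = mat m n (\<lambda>(i,j). A' $$ (i,j) + \<sigma> * u $ i * v $ j)"
      using A by (auto simp: A'_def intro!: eq_matI)
    also have "\<dots> = mat m n (\<lambda>(i,j). \<Sum>l<length (\<sigma> # s). (\<sigma> # s) ! l * (u # us) ! l $ i * (v # vs) ! l $ j)"
      unfolding A'_eq
      by (rule eq_matI) (auto simp: sum.lessThan_Suc_shift simp del: sum.lessThan_Suc)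
    finally have eq: "A = \<dots>" .
    have trip: "A *\<^sub>v (v # vs) ! i = (\<sigma> # s) ! i \<cdot>\<^sub>v (u # us) ! i \<and>
        A\<^sup>T *\<^sub>v (u # us) ! i = (\<sigma> # s) ! i \<cdot>\<^sub>v (v # vs) ! i" if "i < length (\<sigma> # s)" for i
      using that A_vs A_us Av Au by (cases i) auto
    have "orthonormal_list m (u # us)" "orthonormal_list n (v # vs)"
      by (rule orthonormal_list_Cons; use us vs u v uu u_us v_vs len in auto)+
    with sorted trip eq len s \<sigma> show ?thesis
      by (intro exI[of _ "u # us"] exI[of _ "\<sigma> # s"] exI[of _ "v # vs"]) auto
  qed
qed

lemma ex_compact_svd:
  fixes A :: "real mat"
  shows "\<exists>U s V. is_compact_svd A U s V"
proof -
  obtain us s vs where len: "length us = length s" "length vs = length s"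
    and on: "orthonormal_list (dim_row A) us" "orthonormal_list (dim_col A) vs"
    and s: "sorted_wrt (\<ge>) s" "\<forall>x\<in>set s. x > 0"
    and eq: "A = mat (dim_row A) (dim_col A) (\<lambda>(i,j). \<Sum>l<length s. s ! l * us ! l $ i * vs ! l $ j)"
    using ex_singular_triples[of A "dim_row A" "dim_col A" "[]"] by auto
  let ?U = "mat_of_cols (dim_row A) us" and ?V = "mat_of_cols (dim_col A) vs"
  have "A = ?U * mat_diag (length s) (\<lambda>i. s ! i) * ?V\<^sup>T"
    by (subst eq, subst mat_diag_mult_right[of _ "dim_row A"])
      (use len on in \<open>auto simp: scalar_prod_def atLeast0LessThan mat_of_cols_index mult.commute
        intro!: eq_matI sum.cong\<close>)
  moreover have "?U\<^sup>T * ?U = 1\<^sub>m (length s)" "?V\<^sup>T * ?V = 1\<^sub>m (length s)"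
    using orthonormal_list_mat_of_cols[OF on(1)] orthonormal_list_mat_of_cols[OF on(2)] len by auto
  ultimately have "is_compact_svd A ?U s ?V"
    unfolding is_compact_svd_def using s len by auto
  then show ?thesis by blast
qed

text \<open>\<open>compact_svd\<close> is a choice, so its defining property is available only once
  a witness exists; all later facts about it pass through this rule.\<close>

lemma compact_svd_cases:
  obtains U s V where "compact_svd A = (U, s, V)" "is_compact_svd A U s V"
proof -
  obtain U s V where "is_compact_svd A U s V" using ex_compact_svd by blast
  then have "(\<lambda>(U, s, V). is_compact_svd A U s V) (U, s, V)" by simp
  then have "(\<lambda>(U, s, V). is_compact_svd A U s V) (compact_svd A)"
    unfolding compact_svd_def by (rule someI)
  then show thesis using that by (cases "compact_svd A") simp
qed

section \<open>Existence of a best polynomial approximation\<close>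

lemma lagrange_basis:
  fixes x :: "nat \<Rightarrow> 'a::field"
  assumes inj: "inj_on x {..<k}"
  obtains L where "\<And>i. i < k \<Longrightarrow> degree (L i) \<le> k - 1"
    "\<And>i j. i < k \<Longrightarrow> j < k \<Longrightarrow> poly (L i) (x j) = (if i = j then 1 else 0)"
proof
  define L where "L i = (\<Prod>j\<in>{..<k} - {i}. Polynomial.smult (1 / (x i - x j)) [:- x j, 1:])" for i
  show "degree (L i) \<le> k - 1" if "i < k" for i
  proof -
    have "degree (L i) \<le> (\<Sum>j\<in>{..<k} - {i}. degree (Polynomial.smult (1 / (x i - x j)) [:- x j, 1:]))"
      unfolding L_def by (rule degree_prod_sum_le[unfolded comp_def]) simp
    also have "\<dots> \<le> (\<Sum>j\<in>{..<k} - {i}. 1)" by (rule sum_mono) simp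
    also have "\<dots> = k - 1" using that by simp
    finally show ?thesis .
  qed
  show "poly (L i) (x j) = (if i = j then 1 else 0)" if "i < k" "j < k" for i j
  proof (cases "i = j")
    case True
    have "x i - x l \<noteq> 0" if "l \<in> {..<k} - {i}" for l using that inj \<open>i < k\<close> by (auto dest: inj_onD)
    then have "poly (Polynomial.smult (1 / (x i - x l)) [:- x l, 1:]) (x i) = 1" if "l \<in> {..<k} - {i}" for l
      using that by (simp add: diff_divide_distrib[symmetric])
    then have "poly (L i) (x i) = 1"
      unfolding L_def poly_prod by (intro prod.neutral ballI)
    then show ?thesis using True by simp
  next
    case False
    then show ?thesis using that by (auto simp: L_def poly_prod prod_zero_iff)
  qed
qed

text \<open>Replaces an extended-valued supremum by pointwise non-strict inequalities, the form in
  which the sublevel sets below are seen to be closed.\<close>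

lemma sup_norm_le_iff:
  assumes "0 \<le> t"
  shows "sup_norm I g \<le> ennreal t \<longleftrightarrow> (\<forall>z\<in>I. \<bar>g z\<bar> \<le> t)"
  using assms by (simp add: sup_norm_def SUP_le_iff)

text \<open>A polynomial of degree below \<open>k\<close> is parametrised by its values at the \<open>k\<close> nodes
  \<open>\<phi> ` J\<close>. On a sublevel set of the error these values stay in a box, and the sublevel sets are closed,
  so compactness gives a common point of all nonempty ones.\<close>

lemma ex_poly_min:
  fixes h w \<phi> :: "real \<Rightarrow> real"
  assumes J: "finite J" "card J = k" "J \<subseteq> I" and k: "k \<ge> 1"
    and inj: "inj_on \<phi> J" and w: "\<And>z. z \<in> J \<Longrightarrow> w z \<noteq> 0"
  shows "\<exists>\<mu>. is_poly_min (k - 1) (\<lambda>p. sup_norm I (\<lambda>z. h z - poly p (\<phi> z) * w z)) \<mu>"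
proof -
  define E where "E p = sup_norm I (\<lambda>z. h z - poly p (\<phi> z) * w z)" for p
  have E_le: "E p \<le> ennreal t \<longleftrightarrow> (\<forall>z\<in>I. \<bar>h z - poly p (\<phi> z) * w z\<bar> \<le> t)" if "0 \<le> t" for p t
    unfolding E_def by (rule sup_norm_le_iff[OF that])
  have "\<exists>p. is_arg_min E (\<lambda>p. degree p \<le> k - 1) p"
  proof (cases "\<forall>p. degree p \<le> k - 1 \<longrightarrow> E p = \<infinity>")
    \<comment> \<open>If every admissible polynomial has infinite error, each of them is a
      minimiser, for instance 0.\<close>
    case True
    then show ?thesis by (intro exI[of _ 0]) (auto simp: is_arg_min_def)
  next
    case False
    then obtain p0 where p0: "degree p0 \<le> k - 1" "E p0 \<noteq> \<infinity>" by blast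
    define t0 where "t0 = enn2real (E p0)"
    have t0: "0 \<le> t0" "E p0 = ennreal t0" using p0 by (simp_all add: t0_def less_top)
    obtain z where z: "bij_betw z {..<k} J"
      using ex_bij_betw_nat_finite[OF J(1)] J(2) by (auto simp: atLeast0LessThan)
    have zJ: "z i \<in> J" if "i < k" for i using z that by (auto simp: bij_betw_def)
    define x where "x i = \<phi> (z i)" for i
    have injx: "inj_on x {..<k}"
      using z inj comp_inj_on[of z "{..<k}" \<phi>] by (simp add: bij_betw_def x_def[abs_def] comp_def)
    from lagrange_basis[OF injx] obtain L where degL: "\<And>i. i < k \<Longrightarrow> degree (L i) \<le> k - 1"
      and polyL: "\<And>i j. i < k \<Longrightarrow> j < k \<Longrightarrow> poly (L i) (x j) = (if i = j then 1 else 0)" by blast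
    define ip where "ip y = (\<Sum>i<k. Polynomial.smult (y i) (L i))" for y
    have poly_ip: "poly (ip y) t = (\<Sum>i<k. y i * poly (L i) t)" for y t
      by (simp add: ip_def poly_sum)
    have deg_ip: "degree (ip y) \<le> k - 1" for y
      unfolding ip_def by (intro degree_sum_le) (auto intro!: order_trans[OF degree_smult_le] degL simp del: One_nat_def)
    define vals where "vals p i = (if i < k then poly p (x i) else 0)" for p i
    have ip_vals: "ip (vals p) = p" if "degree p \<le> k - 1" for p
    proof (rule poly_eqI_degree[of "x ` {..<k}"])
      fix t assume "t \<in> x ` {..<k}"
      then obtain j where j: "j < k" "t = x j" by auto
      have "poly (ip (vals p)) t = (\<Sum>i<k. vals p i * (if i = j then 1 else 0))"
        unfolding poly_ip j(2) by (rule sum.cong) (use polyL j in auto)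
      also have "\<dots> = poly p t" using j by (simp add: vals_def if_distrib cong: if_cong)
      finally show "poly (ip (vals p)) t = poly p t" .
    next
      \<comment> \<open>Two polynomials of degree at most k - 1 that agree at k nodes coincide; k
        \<ge> 1 makes k - 1 smaller than k.\<close>
      have card: "card (x ` {..<k}) = k" using injx by (simp add: card_image)
      show "degree (ip (vals p)) < card (x ` {..<k})" using deg_ip[of "vals p"] k unfolding card by linarith
      show "degree p < card (x ` {..<k})" using that k unfolding card by linarith
    qed
    \<comment> \<open>Radius of the box: an error of at most \<open>t0\<close> at the node
      \<open>z i\<close> bounds |p(x i)| |w(z i)| by |h(z i)| + \<open>t0\<close>, and w does not
      vanish at the nodes.\<close>
    define c where "c i = (\<bar>h (z i)\<bar> + t0) / \<bar>w (z i)\<bar>" for i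
    define K where "K = PiE UNIV (\<lambda>i. if i < k then {- c i..c i} else {0})"
    define G where "G t = {y. \<forall>z\<in>I. \<bar>h z - poly (ip y) (\<phi> z) * w z\<bar> \<le> t}" for t
    \<comment> \<open>For fixed z the error depends continuously on the node values y, so each z
      contributes a closed condition.\<close>
    have closedG: "closed (G t)" for t
    proof -
    have "G t = (\<Inter>z\<in>I. {y. \<bar>h z - (\<Sum>i<k. y i * poly (L i) (\<phi> z)) * w z\<bar> \<le> t})"
      by (auto simp: G_def poly_ip)
    then show ?thesis
      by (auto intro!: closed_Collect_le continuous_intros continuous_on_coordinate)
  qed
  have vals_G: "vals p \<in> G t" if "degree p \<le> k - 1" "E p \<le> ennreal t" "0 \<le> t" for p t
      using that by (simp add: G_def ip_vals E_le)
    have vals_K: "vals p \<in> K" if p: "degree p \<le> k - 1" "E p \<le> ennreal t0" for p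
    proof -
      have "\<bar>poly p (x i)\<bar> \<le> c i" if "i < k" for i
      proof -
        have "z i \<in> I" using zJ[OF that] J by auto
        then have "\<bar>h (z i) - poly p (x i) * w (z i)\<bar> \<le> t0"
          using p t0 E_le[of t0 p] by (simp add: x_def)
        then have "\<bar>poly p (x i)\<bar> * \<bar>w (z i)\<bar> \<le> \<bar>h (z i)\<bar> + t0"
          unfolding abs_mult[symmetric] by linarith
        then show ?thesis using w[OF zJ[OF that]] by (simp add: c_def field_simps)
      qed
      then show ?thesis by (auto simp: K_def vals_def PiE_def Pi_def extensional_def abs_le_iff minus_le_iff)
    qed
    \<comment> \<open>The levels up to \<open>t0\<close> whose sublevel sets contain some admissible
      polynomial.\<close>
    define T where "T = {t. 0 \<le> t \<and> t \<le> t0 \<and> (\<exists>p. degree p \<le> k - 1 \<and> E p \<le> ennreal t)}"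
    have t0T: "t0 \<in> T" using t0 p0 by (auto simp: T_def)
    have "K \<inter> (\<Inter>t\<in>T. G t) \<noteq> {}"
    proof (rule compact_imp_fip_image)
      show "compact K" unfolding K_def by (rule compact_box)
      show "closed (G t)" for t by (rule closedG)
    next
      fix T' assume T': "finite T'" "T' \<subseteq> T"
      \<comment> \<open>Sublevel sets are nested, so a polynomial for the smallest level serves all
        of \<open>T'\<close>; inserting \<open>t0\<close> covers an empty \<open>T'\<close>.\<close>
      define t where "t = Min (insert t0 T')"
      have "t \<in> insert t0 T'" unfolding t_def using T' by (intro Min_in) auto
      then have "t \<in> T" using T' t0T by auto
      then obtain p where p: "degree p \<le> k - 1" "E p \<le> ennreal t" and t: "0 \<le> t" "t \<le> t0"
        by (auto simp: T_def)
      have "E p \<le> ennreal t0" using p(2) t by (meson ennreal_leI order_trans)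
      then have "vals p \<in> K" using vals_K p by blast
      moreover have "vals p \<in> G t'" if "t' \<in> T'" for t'
      proof -
        have "t \<le> t'" unfolding t_def using T' that by simp
        then show ?thesis using vals_G[OF p t(1)] by (force simp: G_def)
      qed
      ultimately show "K \<inter> (\<Inter>t\<in>T'. G t) \<noteq> {}" by blast
    qed
    then obtain y where y: "\<And>t. t \<in> T \<Longrightarrow> y \<in> G t" by blast
    have Ey: "E (ip y) \<le> ennreal t" if "t \<in> T" for t
      using y[OF that] that E_le[of t "ip y"] by (auto simp: G_def T_def)
    have "\<not> E q < E (ip y)" if q: "degree q \<le> k - 1" for q
    proof
      assume less: "E q < E (ip y)"
      \<comment> \<open>A better q would have finite error, and this error would itself be a level
        in \<open>T\<close>, which the error of \<open>ip y\<close> does not exceed.\<close>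
      define t where "t = enn2real (E q)"
      have "E q < ennreal t0" using less Ey[OF t0T] by (rule less_le_trans)
      then have "E q < \<infinity>" using ennreal_less_top less_trans by (metis infinity_ennreal_def)
      then have t: "E q = ennreal t" "0 \<le> t" by (simp_all add: t_def)
      then have "t \<in> T" using q \<open>E q < ennreal t0\<close> t0 by (auto simp: T_def ennreal_less_iff intro!: exI[of _ q])
      then show False using Ey[of t] less t by simp
    qed
    then show ?thesis using deg_ip[of y] by (intro exI[of _ "ip y"]) (auto simp: is_arg_min_def)
  qed
  then show ?thesis unfolding is_poly_min_def E_def by blast
qed

text \<open>Covers both error functions of the theorem, with weight w(z) = z and with w = 1. A
  degenerate interval has too few points for k > 1 nodes and is treated directly.\<close>

lemma ex_poly_min_interval:
  fixes h w :: "real \<Rightarrow> real"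
  assumes k: "k \<ge> 1" and ab: "0 \<le> a" "a \<le> b" and w: "\<And>z. 0 < z \<Longrightarrow> w z \<noteq> 0" and h0: "h 0 = 0"
  shows "\<exists>\<mu>. is_poly_min (k - 1) (\<lambda>p. sup_norm {a..b} (\<lambda>z. h z - poly p (z\<^sup>2) * w z)) \<mu>"
proof (cases "a = b")
  case True
  \<comment> \<open>A constant interpolates at the single point b. At b = 0 the weight may vanish,
    and there h 0 = 0 makes the zero polynomial exact.\<close>
  define p where "p = (if b = 0 then 0 else [:h b / w b:])"
  have "sup_norm {a..b} (\<lambda>z. h z - poly p (z\<^sup>2) * w z) = 0"
    using ab w[of b] True h0 by (simp add: p_def sup_norm_def)
  moreover have "degree p \<le> k - 1" by (simp add: p_def)
  ultimately show ?thesis unfolding is_poly_min_def is_arg_min_def by fastforce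
next
  case False
  \<comment> \<open>Equally spaced nodes in (a, b]. Using \<open>Suc i\<close> leaves out the left
    end, which may be 0, so all nodes are positive: w is nonzero there and squaring is
    injective.\<close>
  define g where "g i = a + (b - a) * (real (Suc i) / real k)" for i
  have "inj_on g {..<k}" using False k by (auto simp: inj_on_def g_def)
  moreover have gpos: "a < g i" if "i < k" for i using that False ab by (simp add: g_def)
  moreover have "g i \<le> b" if "i < k" for i
  proof -
    have "(b - a) * (real (Suc i) / real k) \<le> (b - a) * 1"
      by (rule mult_left_mono) (use that ab in auto)
    then show ?thesis by (simp add: g_def)
  qed
  moreover have "inj_on power2 (g ` {..<k})"
  proof (rule inj_onI)
    fix x y assume "x \<in> g ` {..<k}" "y \<in> g ` {..<k}" and eq: "x\<^sup>2 = y\<^sup>2"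
    then have "0 \<le> x" "0 \<le> y" using gpos ab by (force intro: less_imp_le le_less_trans)+
    then show "x = y" using eq by (simp add: power2_eq_iff_nonneg)
  qed
  ultimately show ?thesis using k ab w
    by (intro ex_poly_min[where J = "g ` {..<k}" and \<phi> = power2]) (force simp: card_image)+
qed

section \<open>Generalized matrix functions\<close>

lemma mat_diag_mult_vec:
  assumes "x \<in> carrier_vec r"
  shows "mat_diag r d *\<^sub>v x = vec r (\<lambda>i. d i * x $ i)"
  using assms by (intro eq_vecI)
    (auto simp: mat_diag_def scalar_prod_def if_distrib[of "\<lambda>y. y * _"] cong: if_cong)

lemma vec_norm2_mat_diag_mono:
  assumes "x \<in> carrier_vec r" "\<And>i. i < r \<Longrightarrow> \<bar>d i\<bar> \<le> \<bar>e i\<bar>"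
  shows "vec_norm2 (mat_diag r d *\<^sub>v x) \<le> vec_norm2 (mat_diag r e *\<^sub>v x)"
proof -
  have "(\<Sum>i<r. (d i * x $ i)\<^sup>2) \<le> (\<Sum>i<r. (e i * x $ i)\<^sup>2)"
    by (intro sum_mono) (use assms(2) in \<open>auto simp: power_mult_distrib abs_le_square_iff intro!: mult_right_mono\<close>)
  then show ?thesis
    by (simp add: mat_diag_mult_vec[OF assms(1)] vec_norm2_eq_L2_set L2_set_def)
qed

lemma vec_norm2_mat_diag_const:
  assumes "x \<in> carrier_vec r"
  shows "vec_norm2 (mat_diag r (\<lambda>_. c) *\<^sub>v x) = \<bar>c\<bar> * vec_norm2 x"
proof -
  have "mat_diag r (\<lambda>_. c) *\<^sub>v x = c \<cdot>\<^sub>v x"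
    using assms by (auto simp: mat_diag_mult_vec)
  then show ?thesis by (simp add: vec_norm2_smult)
qed

lemma triple_mult_mat_vec:
  fixes U W D :: "real mat"
  assumes "U \<in> carrier_mat m r" "D \<in> carrier_mat r r" "W \<in> carrier_mat r n" "x \<in> carrier_vec n"
  shows "(U * D * W) *\<^sub>v x = U *\<^sub>v (D *\<^sub>v (W *\<^sub>v x))"
  using assms by (simp add: assoc_mult_mat_vec[of _ m r _ n] assoc_mult_mat_vec[of _ m r _ r])

definition nonzero_singular_values :: "real mat \<Rightarrow> real set" where
  "nonzero_singular_values A = set (fst (snd (compact_svd A)))"

lemma finite_nonzero_singular_values [simp]: "finite (nonzero_singular_values A)"
  by (simp add: nonzero_singular_values_def)

text \<open>All clauses share one chosen SVD, so A, its transpose and every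
  \<open>gen_mat_fun f A\<close> act diagonally in the same two bases. The nested products let later
  proofs compute with coordinate vectors.\<close>

lemma svd_decomp:
  assumes A: "A \<in> carrier_mat m n"
  obtains U s V where "compact_svd A = (U, s, V)"
    "U \<in> carrier_mat m (length s)" "V \<in> carrier_mat n (length s)"
    "U\<^sup>T * U = 1\<^sub>m (length s)" "V\<^sup>T * V = 1\<^sub>m (length s)"
    "sorted_wrt (\<ge>) s" "\<And>x. x \<in> set s \<Longrightarrow> x > 0"
    "nonzero_singular_values A = set s"
    "\<And>f x. x \<in> carrier_vec n \<Longrightarrow> gen_mat_fun f A *\<^sub>v x = U *\<^sub>v (mat_diag (length s) (\<lambda>i. f (s ! i)) *\<^sub>v (V\<^sup>T *\<^sub>v x))"
    "\<And>x. x \<in> carrier_vec n \<Longrightarrow> A *\<^sub>v x = U *\<^sub>v (mat_diag (length s) (\<lambda>i. s ! i) *\<^sub>v (V\<^sup>T *\<^sub>v x))"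
    "\<And>y. y \<in> carrier_vec m \<Longrightarrow> A\<^sup>T *\<^sub>v y = V *\<^sub>v (mat_diag (length s) (\<lambda>i. s ! i) *\<^sub>v (U\<^sup>T *\<^sub>v y))"
proof -
  obtain U s V where eq: "compact_svd A = (U, s, V)" and svd: "is_compact_svd A U s V"
    by (rule compact_svd_cases)
  let ?r = "length s" and ?D = "mat_diag (length s) (\<lambda>i. s ! i)"
  from svd A have U: "U \<in> carrier_mat m ?r" and V: "V \<in> carrier_mat n ?r"
    and A_eq: "A = U * ?D * V\<^sup>T"
    by (auto simp: is_compact_svd_def)
  have "?D\<^sup>T = ?D" by (auto simp: mat_diag_def)
  then have "A\<^sup>T = V * (?D * U\<^sup>T)"
    using U V by (simp add: A_eq transpose_mult[of _ m ?r _ n] transpose_mult[of _ m ?r _ ?r])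
  then have AT: "A\<^sup>T = V * ?D * U\<^sup>T"
    using U V by (simp add: assoc_mult_mat[of _ n ?r _ ?r _ m])
  show thesis
  proof (rule that[OF eq U V])
    show "A *\<^sub>v x = U *\<^sub>v (?D *\<^sub>v (V\<^sup>T *\<^sub>v x))" if "x \<in> carrier_vec n" for x
      by (subst A_eq, rule triple_mult_mat_vec[OF U _ _ that]) (use V in auto)
    show "A\<^sup>T *\<^sub>v y = V *\<^sub>v (?D *\<^sub>v (U\<^sup>T *\<^sub>v y))" if "y \<in> carrier_vec m" for y
      unfolding AT by (rule triple_mult_mat_vec[OF V _ _ that]) (use U in auto)
    show "gen_mat_fun f A *\<^sub>v x = U *\<^sub>v (mat_diag ?r (\<lambda>i. f (s ! i)) *\<^sub>v (V\<^sup>T *\<^sub>v x))"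
      if "x \<in> carrier_vec n" for f x
      unfolding gen_mat_fun_def eq prod.case by (rule triple_mult_mat_vec[OF U _ _ that]) (use V in auto)
  qed (use svd eq in \<open>auto simp: is_compact_svd_def nonzero_singular_values_def\<close>)
qed

lemma gen_mat_fun_carrier [simp]:
  assumes "A \<in> carrier_mat m n"
  shows "gen_mat_fun f A \<in> carrier_mat m n"
proof -
  obtain U s V where "compact_svd A = (U, s, V)" "is_compact_svd A U s V"
    by (rule compact_svd_cases)
  then have "U \<in> carrier_mat m (length s)" "V \<in> carrier_mat n (length s)"
    using assms unfolding is_compact_svd_def by auto
  then show ?thesis by (intro carrier_matI) (auto simp: gen_mat_fun_def \<open>compact_svd A = (U, s, V)\<close>)
qed

lemma gen_mat_fun_ident:
  assumes "A \<in> carrier_mat m n" "x \<in> carrier_vec n"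
  shows "gen_mat_fun (\<lambda>z. z) A *\<^sub>v x = A *\<^sub>v x"
  by (rule svd_decomp[OF assms(1)]) (simp only: assms)

text \<open>The coefficient c lets one rule serve sums of monomials, the splitting of f into error
  and polynomial, and the zero function.\<close>

lemma gen_mat_fun_add_smult:
  assumes A: "A \<in> carrier_mat m n" and x: "x \<in> carrier_vec n"
  shows "gen_mat_fun (\<lambda>z. f z + c * g z) A *\<^sub>v x = gen_mat_fun f A *\<^sub>v x + c \<cdot>\<^sub>v (gen_mat_fun g A *\<^sub>v x)"
proof (rule svd_decomp[OF A])
  fix U V :: "real mat" and s :: "real list"
  let ?r = "length s"
  assume U: "U \<in> carrier_mat m ?r" and V: "V \<in> carrier_mat n ?r"
    and gen: "\<And>f x. x \<in> carrier_vec n \<Longrightarrow>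
      gen_mat_fun f A *\<^sub>v x = U *\<^sub>v (mat_diag ?r (\<lambda>i. f (s ! i)) *\<^sub>v (V\<^sup>T *\<^sub>v x))"
  define y where "y = V\<^sup>T *\<^sub>v x"
  have y: "y \<in> carrier_vec ?r" using V x by (simp add: y_def)
  have "mat_diag ?r (\<lambda>i. f (s ! i) + c * g (s ! i)) *\<^sub>v y
      = mat_diag ?r (\<lambda>i. f (s ! i)) *\<^sub>v y + c \<cdot>\<^sub>v (mat_diag ?r (\<lambda>i. g (s ! i)) *\<^sub>v y)"
    using y by (auto simp: mat_diag_mult_vec algebra_simps)
  then show ?thesis
    unfolding gen[OF x] y_def[symmetric] using U y
    by (simp add: mult_add_distrib_mat_vec[of _ m ?r] mult_mat_vec[of _ m ?r] mult_mat_vec_carrier[of _ ?r ?r])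
qed

text \<open>In the coordinates V^T x the Gram matrix A^T A acts as the squared diagonal, because U^T
  U and V^T V cancel.\<close>

lemma gen_mat_fun_mult_gram:
  assumes A: "A \<in> carrier_mat m n" and x: "x \<in> carrier_vec n"
  shows "gen_mat_fun (\<lambda>z. f z * z\<^sup>2) A *\<^sub>v x = gen_mat_fun f A *\<^sub>v ((A\<^sup>T * A) *\<^sub>v x)"
proof (rule svd_decomp[OF A])
  fix U V :: "real mat" and s :: "real list"
  let ?r = "length s"
  let ?D = "mat_diag ?r (\<lambda>i. s ! i)"
  assume U: "U \<in> carrier_mat m ?r" and V: "V \<in> carrier_mat n ?r"
    and on: "U\<^sup>T * U = 1\<^sub>m ?r" "V\<^sup>T * V = 1\<^sub>m ?r"
    and gen: "\<And>f x. x \<in> carrier_vec n \<Longrightarrow>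
      gen_mat_fun f A *\<^sub>v x = U *\<^sub>v (mat_diag ?r (\<lambda>i. f (s ! i)) *\<^sub>v (V\<^sup>T *\<^sub>v x))"
    and Ax: "\<And>x. x \<in> carrier_vec n \<Longrightarrow> A *\<^sub>v x = U *\<^sub>v (?D *\<^sub>v (V\<^sup>T *\<^sub>v x))"
    and ATy: "\<And>y. y \<in> carrier_vec m \<Longrightarrow> A\<^sup>T *\<^sub>v y = V *\<^sub>v (?D *\<^sub>v (U\<^sup>T *\<^sub>v y))"
  define y where "y = V\<^sup>T *\<^sub>v x"
  have y: "y \<in> carrier_vec ?r" using V x by (simp add: y_def)
  have Dc: "mat_diag ?r d *\<^sub>v z \<in> carrier_vec ?r" for d :: "nat \<Rightarrow> real" and z
    by (rule carrier_vecI) (simp add: mat_diag_def)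
  have "V\<^sup>T *\<^sub>v ((A\<^sup>T * A) *\<^sub>v x) = V\<^sup>T *\<^sub>v (A\<^sup>T *\<^sub>v (A *\<^sub>v x))"
    using A x by (simp add: assoc_mult_mat_vec[of _ n m _ n])
  also have "A *\<^sub>v x = U *\<^sub>v (?D *\<^sub>v y)"
    unfolding y_def by (rule Ax[OF x])
  also have "A\<^sup>T *\<^sub>v \<dots> = V *\<^sub>v (?D *\<^sub>v (U\<^sup>T *\<^sub>v \<dots>))"
    by (rule ATy) (rule mult_mat_vec_carrier[OF U Dc])
  also have "U\<^sup>T *\<^sub>v (U *\<^sub>v (?D *\<^sub>v y)) = ?D *\<^sub>v y"
    by (rule orthonormal_cols_mult_vec[OF U on(1) Dc])
  also have "V\<^sup>T *\<^sub>v (V *\<^sub>v (?D *\<^sub>v (?D *\<^sub>v y))) = ?D *\<^sub>v (?D *\<^sub>v y)"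
    by (rule orthonormal_cols_mult_vec[OF V on(2) Dc])
  also have "mat_diag ?r (\<lambda>i. f (s ! i)) *\<^sub>v \<dots> = mat_diag ?r (\<lambda>i. f (s ! i) * (s ! i)\<^sup>2) *\<^sub>v y"
    using y Dc by (auto simp: mat_diag_mult_vec power2_eq_square)
  finally have "mat_diag ?r (\<lambda>i. f (s ! i)) *\<^sub>v (V\<^sup>T *\<^sub>v ((A\<^sup>T * A) *\<^sub>v x))
      = mat_diag ?r (\<lambda>i. f (s ! i) * (s ! i)\<^sup>2) *\<^sub>v y" .
  moreover have "(A\<^sup>T * A) *\<^sub>v x \<in> carrier_vec n"
    by (rule mult_mat_vec_carrier[OF mult_carrier_mat[OF _ A] x]) (use A in auto)
  ultimately show ?thesis by (simp only: gen[OF x] gen y_def)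
qed

text \<open>Each factor z^2 moves one Gram matrix onto the vector, and the remaining factor z
  becomes A. This links odd polynomials to Krylov vectors.\<close>

lemma gen_mat_fun_odd_monom:
  assumes A: "A \<in> carrier_mat m n" and x: "x \<in> carrier_vec n"
  shows "gen_mat_fun (\<lambda>z. (z\<^sup>2) ^ i * z) A *\<^sub>v x = A *\<^sub>v ((A\<^sup>T * A) ^\<^sub>m i *\<^sub>v x)"
  using x
proof (induction i arbitrary: x)
  case 0
  then show ?case using A by (simp add: gen_mat_fun_ident)
next
  case (Suc i)
  have M: "A\<^sup>T * A \<in> carrier_mat n n" using A by simp
  have "gen_mat_fun (\<lambda>z. (z\<^sup>2) ^ Suc i * z) A *\<^sub>v x = gen_mat_fun (\<lambda>z. (z\<^sup>2) ^ i * z) A *\<^sub>v ((A\<^sup>T * A) *\<^sub>v x)"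
    using gen_mat_fun_mult_gram[OF A Suc.prems, of "\<lambda>z. (z\<^sup>2) ^ i * z"] by (simp add: mult_ac)
  also have "\<dots> = A *\<^sub>v ((A\<^sup>T * A) ^\<^sub>m i *\<^sub>v ((A\<^sup>T * A) *\<^sub>v x))"
    by (rule Suc.IH) (rule mult_mat_vec_carrier[OF M Suc.prems])
  also have "\<dots> = A *\<^sub>v ((A\<^sup>T * A) ^\<^sub>m Suc i *\<^sub>v x)"
    using assoc_mult_mat_vec[OF pow_carrier_mat[OF M] M Suc.prems] by simp
  finally show ?case .
qed

text \<open>U preserves norms, so only diagonal factors are compared. With f the identity the
  right-hand norm is that of A x, as the second bound requires.\<close>

lemma vec_norm2_gen_mat_fun_mult_le:
  assumes A: "A \<in> carrier_mat m n" and x: "x \<in> carrier_vec n"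
    and g: "\<And>z. z \<in> nonzero_singular_values A \<Longrightarrow> \<bar>g z\<bar> \<le> C"
  shows "vec_norm2 (gen_mat_fun (\<lambda>z. g z * f z) A *\<^sub>v x) \<le> \<bar>C\<bar> * vec_norm2 (gen_mat_fun f A *\<^sub>v x)"
proof (rule svd_decomp[OF A])
  fix U V :: "real mat" and s :: "real list"
  let ?r = "length s"
  let ?D = "\<lambda>f. mat_diag ?r (\<lambda>i. f (s ! i)) :: real mat"
  assume U: "U \<in> carrier_mat m ?r" and V: "V \<in> carrier_mat n ?r"
    and on: "U\<^sup>T * U = 1\<^sub>m ?r"
    and ns: "nonzero_singular_values A = set s"
    and gen: "\<And>f x. x \<in> carrier_vec n \<Longrightarrow> gen_mat_fun f A *\<^sub>v x = U *\<^sub>v (?D f *\<^sub>v (V\<^sup>T *\<^sub>v x))"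
  define y where "y = V\<^sup>T *\<^sub>v x"
  have y: "y \<in> carrier_vec ?r" using V x by (simp add: y_def)
  have Dc: "?D h *\<^sub>v z \<in> carrier_vec ?r" for h z
    by (rule carrier_vecI) (simp add: mat_diag_def)
  have norm: "vec_norm2 (gen_mat_fun h A *\<^sub>v x) = vec_norm2 (?D h *\<^sub>v y)" for h
    unfolding gen[OF x] y_def[symmetric] by (rule vec_norm2_orthonormal_cols[OF U on Dc])
  have "?D (\<lambda>z. g z * f z) *\<^sub>v y = ?D g *\<^sub>v (?D f *\<^sub>v y)"
    using y Dc by (auto simp: mat_diag_mult_vec)
  then have "vec_norm2 (?D (\<lambda>z. g z * f z) *\<^sub>v y) \<le> vec_norm2 (mat_diag ?r (\<lambda>_. C) *\<^sub>v (?D f *\<^sub>v y))"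
    using g by (auto intro!: vec_norm2_mat_diag_mono Dc order_trans[OF g abs_ge_self] simp: ns)
  then show ?thesis
    unfolding norm by (simp add: vec_norm2_mat_diag_const[OF Dc])
qed

text \<open>The absolute value of C keeps the bound true when there are no nonzero singular values
  and C is arbitrary.\<close>

lemma vec_norm2_gen_mat_fun_le:
  assumes A: "A \<in> carrier_mat m n" and x: "x \<in> carrier_vec n"
    and g: "\<And>z. z \<in> nonzero_singular_values A \<Longrightarrow> \<bar>g z\<bar> \<le> C"
  shows "vec_norm2 (gen_mat_fun g A *\<^sub>v x) \<le> \<bar>C\<bar> * vec_norm2 x"
proof (rule svd_decomp[OF A])
  fix U V :: "real mat" and s :: "real list"
  let ?r = "length s"
  assume U: "U \<in> carrier_mat m ?r" and V: "V \<in> carrier_mat n ?r"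
    and on: "U\<^sup>T * U = 1\<^sub>m ?r" "V\<^sup>T * V = 1\<^sub>m ?r"
    and ns: "nonzero_singular_values A = set s"
    and gen: "\<And>f x. x \<in> carrier_vec n \<Longrightarrow>
      gen_mat_fun f A *\<^sub>v x = U *\<^sub>v (mat_diag ?r (\<lambda>i. f (s ! i)) *\<^sub>v (V\<^sup>T *\<^sub>v x))"
  have y: "V\<^sup>T *\<^sub>v x \<in> carrier_vec ?r" using V x by simp
  have "vec_norm2 (gen_mat_fun g A *\<^sub>v x) = vec_norm2 (mat_diag ?r (\<lambda>i. g (s ! i)) *\<^sub>v (V\<^sup>T *\<^sub>v x))"
    unfolding gen[OF x] by (rule vec_norm2_orthonormal_cols[OF U on(1)])
      (rule carrier_vecI, simp add: mat_diag_def)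
  also have "\<dots> \<le> vec_norm2 (mat_diag ?r (\<lambda>_. C) *\<^sub>v (V\<^sup>T *\<^sub>v x))"
    using g by (auto intro!: vec_norm2_mat_diag_mono y order_trans[OF g abs_ge_self] simp: ns)
  also have "\<dots> \<le> \<bar>C\<bar> * vec_norm2 x"
    unfolding vec_norm2_mat_diag_const[OF y]
    by (intro mult_left_mono vec_norm2_transpose_orthonormal_cols[OF V on(2) x]) simp
  finally show ?thesis .
qed

section \<open>Extreme singular values as bounds for |A x|\<close>

lemma nonzero_singular_values_bounds:
  assumes A: "A \<in> carrier_mat m n" and d: "n \<le> d" and \<sigma>: "\<sigma> \<in> nonzero_singular_values A"
  shows "singular_value A d \<le> \<sigma>" "\<sigma> \<le> singular_value A 1" "0 < \<sigma>"
proof -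
  obtain U s V where eq: "compact_svd A = (U, s, V)" and V: "V \<in> carrier_mat n (length s)"
    "V\<^sup>T * V = 1\<^sub>m (length s)" and s: "sorted_wrt (\<ge>) s" "\<And>x. x \<in> set s \<Longrightarrow> x > 0"
    and ns: "nonzero_singular_values A = set s"
    by (rule svd_decomp[OF A]) blast
  have len: "length s \<le> n" by (rule orthonormal_cols_le[OF V])
  from \<sigma> obtain i where i: "i < length s" "\<sigma> = s ! i" by (auto simp: ns in_set_conv_nth)
  show pos: "0 < \<sigma>" using \<sigma> s ns by auto
  have mono: "s ! b \<le> s ! a" if "a \<le> b" "b < length s" for a b
    using that s(1) by (cases "a = b") (auto simp: sorted_wrt_iff_nth_less)
  show "\<sigma> \<le> singular_value A 1"
    using i mono[of 0 i] by (simp add: singular_value_def eq)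
  \<comment> \<open>The list has at most n \<le> d entries, so number d is either its last entry or
    the default value 0.\<close>
  show "singular_value A d \<le> \<sigma>"
    using i mono[of i "d - 1"] pos len d by (auto simp: singular_value_def eq)
qed

lemma singular_value_nonneg: "0 \<le> singular_value A j"
proof -
  obtain U s V where "compact_svd A = (U, s, V)" "\<And>x. x \<in> set s \<Longrightarrow> x > 0"
    by (rule svd_decomp[OF carrier_mat_triv[of A]]) blast
  then show ?thesis by (auto simp: singular_value_def less_imp_le)
qed

lemma vec_norm2_mult_le_singular_value:
  assumes A: "A \<in> carrier_mat m n" and x: "x \<in> carrier_vec n"
  shows "vec_norm2 (A *\<^sub>v x) \<le> singular_value A 1 * vec_norm2 x"
proof -
  have "vec_norm2 (gen_mat_fun (\<lambda>z. z) A *\<^sub>v x) \<le> \<bar>singular_value A 1\<bar> * vec_norm2 x"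
    by (rule vec_norm2_gen_mat_fun_le[OF A x])
      (use nonzero_singular_values_bounds[OF A order_refl] in \<open>simp add: less_imp_le\<close>)
  then show ?thesis by (simp add: gen_mat_fun_ident[OF A x] singular_value_nonneg)
qed

text \<open>If \<open>singular_value A d\<close> is nonzero, the length r of the list satisfies d
  \<le> r \<le> n \<le> d. Then V is square and orthogonal, V^T preserves norms, and the smallest
  diagonal entry bounds |A x| from below.\<close>

lemma singular_value_le_vec_norm2_mult:
  assumes A: "A \<in> carrier_mat m n" and d: "n \<le> d" and x: "x \<in> carrier_vec n"
  shows "singular_value A d * vec_norm2 x \<le> vec_norm2 (A *\<^sub>v x)"
proof (cases "singular_value A d = 0")
  case False
  obtain U s V where eq: "compact_svd A = (U, s, V)" and U: "U \<in> carrier_mat m (length s)"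
    and V: "V \<in> carrier_mat n (length s)"
    and on: "U\<^sup>T * U = 1\<^sub>m (length s)" "V\<^sup>T * V = 1\<^sub>m (length s)"
    and ns: "nonzero_singular_values A = set s"
    and Ax: "A *\<^sub>v x = U *\<^sub>v (mat_diag (length s) (\<lambda>i. s ! i) *\<^sub>v (V\<^sup>T *\<^sub>v x))"
    by (rule svd_decomp[OF A]) (use x in blast)
  let ?r = "length s"
  have "d \<le> ?r" using False by (auto simp: singular_value_def eq split: if_splits)
  with d orthonormal_cols_le[OF V on(2)] have r: "?r = n" by simp
  have VV: "V * V\<^sup>T = 1\<^sub>m n"
    by (rule mat_mult_left_right_inverse[of "V\<^sup>T" n V]) (use V on r in auto)
  have y: "V\<^sup>T *\<^sub>v x \<in> carrier_vec ?r" using V x by simp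
  have "V *\<^sub>v (V\<^sup>T *\<^sub>v x) = (V * V\<^sup>T) *\<^sub>v x"
    by (rule assoc_mult_mat_vec[symmetric, OF V _ x]) (use V in simp)
  then have "V *\<^sub>v (V\<^sup>T *\<^sub>v x) = x" using x by (simp add: VV)
  then have norm: "vec_norm2 (V\<^sup>T *\<^sub>v x) = vec_norm2 x"
    using vec_norm2_orthonormal_cols[OF V on(2) y] by simp
  have "singular_value A d * vec_norm2 x = vec_norm2 (mat_diag ?r (\<lambda>_. singular_value A d) *\<^sub>v (V\<^sup>T *\<^sub>v x))"
    by (simp add: vec_norm2_mat_diag_const[OF y] norm singular_value_nonneg)
  also have "\<dots> \<le> vec_norm2 (mat_diag ?r (\<lambda>i. s ! i) *\<^sub>v (V\<^sup>T *\<^sub>v x))"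
    by (rule vec_norm2_mat_diag_mono[OF y])
      (use nonzero_singular_values_bounds[OF A d] ns in \<open>simp add: singular_value_nonneg less_imp_le\<close>)
  also have "\<dots> = vec_norm2 (A *\<^sub>v x)"
    unfolding Ax by (rule vec_norm2_orthonormal_cols[OF U on(1), symmetric])
      (rule carrier_vecI, simp add: mat_diag_def)
  finally show ?thesis .
qed simp

text \<open>The right singular vector V e_i is the witness. It allows singular values of different
  matrices to be compared through norms of images.\<close>

lemma nonzero_singular_value_attained:
  assumes A: "A \<in> carrier_mat m n" and \<sigma>: "\<sigma> \<in> nonzero_singular_values A"
  obtains x where "x \<in> carrier_vec n" "vec_norm2 x = 1" "vec_norm2 (A *\<^sub>v x) = \<sigma>"
proof (rule svd_decomp[OF A])
  fix U V :: "real mat" and s :: "real list"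
  let ?r = "length s"
  assume U: "U \<in> carrier_mat m ?r" and V: "V \<in> carrier_mat n ?r"
    and on: "U\<^sup>T * U = 1\<^sub>m ?r" "V\<^sup>T * V = 1\<^sub>m ?r"
    and s: "\<And>x. x \<in> set s \<Longrightarrow> x > 0"
    and ns: "nonzero_singular_values A = set s"
    and Ax: "\<And>x. x \<in> carrier_vec n \<Longrightarrow> A *\<^sub>v x = U *\<^sub>v (mat_diag ?r (\<lambda>i. s ! i) *\<^sub>v (V\<^sup>T *\<^sub>v x))"
  from \<sigma> obtain i where i: "i < ?r" "\<sigma> = s ! i" by (auto simp: ns in_set_conv_nth)
  define e :: "real vec" where "e = unit_vec ?r i"
  have e: "e \<in> carrier_vec ?r" by (simp add: e_def)
  have ne: "vec_norm2 e = 1" using i by (simp add: e_def vec_norm2_def)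
  have Ve: "V *\<^sub>v e \<in> carrier_vec n" by (rule mult_mat_vec_carrier[OF V e])
  have "mat_diag ?r (\<lambda>i. s ! i) *\<^sub>v e = \<sigma> \<cdot>\<^sub>v e"
    unfolding mat_diag_mult_vec[OF e] by (rule eq_vecI) (use i in \<open>auto simp: e_def\<close>)
  then have "A *\<^sub>v (V *\<^sub>v e) = U *\<^sub>v (\<sigma> \<cdot>\<^sub>v e)"
    by (simp only: Ax[OF Ve] orthonormal_cols_mult_vec[OF V on(2) e])
  then have "vec_norm2 (A *\<^sub>v (V *\<^sub>v e)) = \<sigma>"
    using vec_norm2_orthonormal_cols[OF U on(1), of "\<sigma> \<cdot>\<^sub>v e"] e ne i s
    by (simp add: vec_norm2_smult less_imp_le)
  then show thesis
    using that[OF Ve] vec_norm2_orthonormal_cols[OF V on(2) e] ne by simp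
qed

section \<open>Krylov spaces and projections onto them\<close>

lemma krylov_member:
  assumes M: "M \<in> carrier_mat d d" and c: "c \<in> carrier_vec d" and i: "i < k"
  shows "(M ^\<^sub>m i) *\<^sub>v c \<in> krylov k M c"
proof -
  interpret vec_space "TYPE(real)" d .
  have "{(M ^\<^sub>m i) *\<^sub>v c | i. i < k} \<subseteq> carrier_vec d"
    using mult_mat_vec_carrier[OF pow_carrier_mat[OF M] c] by auto
  then show ?thesis using in_own_span[of "{(M ^\<^sub>m i) *\<^sub>v c | i. i < k}"] c i
    unfolding krylov_def by auto
qed

text \<open>The set where two linear maps agree is a submodule, so agreement on the generating
  vectors passes to their span.\<close>

lemma krylov_equalizer:
  assumes M: "M \<in> carrier_mat d d" and c: "c \<in> carrier_vec d"
    and C: "C \<in> carrier_mat e d" and D: "D \<in> carrier_mat e d"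
    and eq: "\<And>i. i < k \<Longrightarrow> C *\<^sub>v ((M ^\<^sub>m i) *\<^sub>v c) = D *\<^sub>v ((M ^\<^sub>m i) *\<^sub>v c)"
    and y: "y \<in> krylov k M c"
  shows "C *\<^sub>v y = D *\<^sub>v y"
proof -
  interpret vec_space "TYPE(real)" d .
  let ?S = "{(M ^\<^sub>m i) *\<^sub>v c | i. i < k}" and ?W = "{y \<in> carrier_vec d. C *\<^sub>v y = D *\<^sub>v y}"
  have "?S \<subseteq> ?W"
    using mult_mat_vec_carrier[OF pow_carrier_mat[OF M] c] eq by auto
  moreover have "submodule class_ring ?W V"
    by (rule submodule.intro) (use C D in \<open>auto simp: module_axioms module_vec_simps class_ring_simps
      mult_add_distrib_mat_vec[of _ e d] mult_mat_vec[of _ e d]\<close>)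
  ultimately have "span ?S \<subseteq> ?W" by (rule span_is_subset)
  then show ?thesis using y c by (auto simp: krylov_def)
qed

lemma orthonormal_basis_matrix_project:
  assumes Q: "orthonormal_basis_matrix d k Q W" and y: "y \<in> W"
  shows "Q *\<^sub>v (Q\<^sup>T *\<^sub>v y) = y"
proof -
  interpret vec_space "TYPE(real)" d .
  have Qc: "Q \<in> carrier_mat d k" and on: "Q\<^sup>T * Q = 1\<^sub>m k" and W: "col_space Q = W"
    using Q by (auto simp: orthonormal_basis_matrix_def)
  then obtain x where "x \<in> carrier_vec k" "Q *\<^sub>v x = y"
    using y col_space_eq[OF Qc] by auto
  then show ?thesis using orthonormal_cols_mult_vec[OF Qc on] by auto
qed

lemma mult_vec_in_col_space:
  assumes Q: "orthonormal_basis_matrix d k Q W" and x: "x \<in> carrier_vec k"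
  shows "Q *\<^sub>v x \<in> W"
proof -
  interpret vec_space "TYPE(real)" d .
  have Qc: "Q \<in> carrier_mat d k" and W: "col_space Q = W"
    using Q by (auto simp: orthonormal_basis_matrix_def)
  then show ?thesis using x col_space_eq[OF Qc] by auto
qed

text \<open>A intertwines A^T A with A A^T; hence it carries the Krylov vectors of b to those of A
  b.\<close>

lemma gram_pow_mult_vec:
  fixes A :: "real mat"
  assumes A: "A \<in> carrier_mat m n" and x: "x \<in> carrier_vec n"
  shows "A *\<^sub>v ((A\<^sup>T * A) ^\<^sub>m i *\<^sub>v x) = (A * A\<^sup>T) ^\<^sub>m i *\<^sub>v (A *\<^sub>v x)"
  using x
proof (induction i arbitrary: x)
  case 0
  then show ?case using A by simp
next
  case (Suc i)
  have M: "A\<^sup>T * A \<in> carrier_mat n n" and N: "A * A\<^sup>T \<in> carrier_mat m m" using A by simp_all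
  have Ax: "A *\<^sub>v x \<in> carrier_vec m" by (rule mult_mat_vec_carrier[OF A Suc.prems])
  have "A *\<^sub>v ((A\<^sup>T * A) ^\<^sub>m Suc i *\<^sub>v x) = A *\<^sub>v ((A\<^sup>T * A) ^\<^sub>m i *\<^sub>v ((A\<^sup>T * A) *\<^sub>v x))"
    using assoc_mult_mat_vec[OF pow_carrier_mat[OF M] M Suc.prems] by simp
  also have "\<dots> = (A * A\<^sup>T) ^\<^sub>m i *\<^sub>v (A *\<^sub>v ((A\<^sup>T * A) *\<^sub>v x))"
    by (rule Suc.IH) (rule mult_mat_vec_carrier[OF M Suc.prems])
  also have "A *\<^sub>v ((A\<^sup>T * A) *\<^sub>v x) = (A * A\<^sup>T) *\<^sub>v (A *\<^sub>v x)"
    using A Suc.prems Ax by (simp add: assoc_mult_mat_vec[of _ m n _ m] assoc_mult_mat_vec[of _ n m _ n])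
  also have "(A * A\<^sup>T) ^\<^sub>m i *\<^sub>v \<dots> = (A * A\<^sup>T) ^\<^sub>m Suc i *\<^sub>v (A *\<^sub>v x)"
    using assoc_mult_mat_vec[OF pow_carrier_mat[OF N] N Ax] by simp
  finally show ?case .
qed

lemma pow_mat_Suc_left:
  assumes "M \<in> carrier_mat d d"
  shows "M ^\<^sub>m Suc i = M * M ^\<^sub>m i"
proof (induction i)
  case (Suc i)
  have "M ^\<^sub>m Suc (Suc i) = (M * M ^\<^sub>m i) * M" using Suc by simp
  also have "\<dots> = M * (M ^\<^sub>m i * M)"
    by (rule assoc_mult_mat[OF assms pow_carrier_mat[OF assms] assms])
  finally show ?case by simp
qed (use assms in simp)

section \<open>Krylov approximation\<close>

locale golub_kahan =
  fixes A P Q :: "real mat" and b :: "real vec" and m n k :: nat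
  assumes A: "A \<in> carrier_mat m n" and b: "b \<in> carrier_vec n" and k: "k \<ge> 1"
    and Q: "orthonormal_basis_matrix n k Q (krylov k (A\<^sup>T * A) b)"
    and P: "orthonormal_basis_matrix m k P (krylov k (A * A\<^sup>T) (A *\<^sub>v b))"
begin

definition "M = A\<^sup>T * A"

definition "B = P\<^sup>T * A * Q"

lemma carriers:
  "Q \<in> carrier_mat n k" "P \<in> carrier_mat m k" "M \<in> carrier_mat n n" "B \<in> carrier_mat k k"
  "M ^\<^sub>m i \<in> carrier_mat n n"
  using A Q P by (auto simp: orthonormal_basis_matrix_def M_def B_def intro!: pow_carrier_mat)

lemma orthonormal: "Q\<^sup>T * Q = 1\<^sub>m k" "P\<^sup>T * P = 1\<^sub>m k"
  using Q P by (auto simp: orthonormal_basis_matrix_def)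

lemma krylov_vec: "M ^\<^sub>m i *\<^sub>v b \<in> carrier_vec n"
  by (rule mult_mat_vec_carrier[OF carriers(5) b])

lemma project_Q: "i < k \<Longrightarrow> Q *\<^sub>v (Q\<^sup>T *\<^sub>v (M ^\<^sub>m i *\<^sub>v b)) = M ^\<^sub>m i *\<^sub>v b"
  using orthonormal_basis_matrix_project[OF Q] krylov_member[OF carriers(3) b]
  by (simp add: M_def)

text \<open>By k \<ge> 1 the vector b is itself a Krylov vector (power 0), so projecting loses
  nothing of it.\<close>

lemma project_b: "Q *\<^sub>v (Q\<^sup>T *\<^sub>v b) = b"
  using project_Q[of 0] k b carriers by simp

text \<open>A maps the Krylov space of b into that of A b, which is the column space of P, and P P^T
  fixes that space.\<close>

lemma project_P:
  assumes "y \<in> krylov k M b"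
  shows "P *\<^sub>v (P\<^sup>T *\<^sub>v (A *\<^sub>v y)) = A *\<^sub>v y"
proof -
  have PA: "P * (P\<^sup>T * A) \<in> carrier_mat m n" using carriers A by auto
  have assoc: "(P * (P\<^sup>T * A)) *\<^sub>v x = P *\<^sub>v (P\<^sup>T *\<^sub>v (A *\<^sub>v x))" if "x \<in> carrier_vec n" for x
    using that carriers A by (simp add: assoc_mult_mat_vec[of _ m k _ n] assoc_mult_mat_vec[of _ k m _ n])
  have "y \<in> carrier_vec n"
    using mult_vec_in_col_space Q assms orthonormal_basis_matrix_project[OF Q, of y]
    by (metis M_def carriers(1) carrier_vecI carrier_matD(1) dim_mult_mat_vec)
  moreover have "(P * (P\<^sup>T * A)) *\<^sub>v y = A *\<^sub>v y"
  proof (rule krylov_equalizer[OF carriers(3) b PA A _ assms])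
    fix i assume i: "i < k"
    have N: "A * A\<^sup>T \<in> carrier_mat m m" and Ab: "A *\<^sub>v b \<in> carrier_vec m"
      using A b by (auto intro: mult_mat_vec_carrier)
    have "A *\<^sub>v (M ^\<^sub>m i *\<^sub>v b) \<in> krylov k (A * A\<^sup>T) (A *\<^sub>v b)"
      unfolding M_def gram_pow_mult_vec[OF A b] by (rule krylov_member[OF N Ab i])
    from orthonormal_basis_matrix_project[OF P this]
    show "(P * (P\<^sup>T * A)) *\<^sub>v (M ^\<^sub>m i *\<^sub>v b) = A *\<^sub>v (M ^\<^sub>m i *\<^sub>v b)"
      by (simp add: assoc krylov_vec)
  qed
  ultimately show ?thesis by (simp add: assoc)
qed

lemma B_mult_vec:
  assumes "x \<in> carrier_vec k"
  shows "B *\<^sub>v x = P\<^sup>T *\<^sub>v (A *\<^sub>v (Q *\<^sub>v x))"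
proof -
  have PA: "P\<^sup>T * A \<in> carrier_mat k n" using carriers A by auto
  have "B *\<^sub>v x = (P\<^sup>T * A) *\<^sub>v (Q *\<^sub>v x)"
    unfolding B_def by (rule assoc_mult_mat_vec[OF PA carriers(1) assms])
  also have "\<dots> = P\<^sup>T *\<^sub>v (A *\<^sub>v (Q *\<^sub>v x))"
    by (rule assoc_mult_mat_vec[OF _ A mult_mat_vec_carrier[OF carriers(1) assms]]) (use carriers in auto)
  finally show ?thesis .
qed

lemma BT_mult_vec:
  assumes "y \<in> carrier_vec k"
  shows "B\<^sup>T *\<^sub>v y = Q\<^sup>T *\<^sub>v (A\<^sup>T *\<^sub>v (P *\<^sub>v y))"
proof -
  have PA: "P\<^sup>T * A \<in> carrier_mat k n" using carriers A by auto
  have "B\<^sup>T = Q\<^sup>T * (P\<^sup>T * A)\<^sup>T"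
    unfolding B_def by (rule transpose_mult[OF PA carriers(1)])
  also have "(P\<^sup>T * A)\<^sup>T = A\<^sup>T * P"
    using transpose_mult[of "P\<^sup>T" k m A n] carriers A by simp
  finally have "B\<^sup>T = Q\<^sup>T * (A\<^sup>T * P)" .
  moreover have "Q\<^sup>T * (A\<^sup>T * P) *\<^sub>v y = Q\<^sup>T *\<^sub>v (A\<^sup>T *\<^sub>v (P *\<^sub>v y))"
    using carriers A assms by (simp add: assoc_mult_mat_vec[of _ k n _ k] assoc_mult_mat_vec[of _ n m _ k])
  ultimately show ?thesis by simp
qed

text \<open>A (Q x) lies in the column space of P, so it equals P (B x), and P preserves
  norms.\<close>

lemma norm_B_mult_vec:
  assumes x: "x \<in> carrier_vec k"
  shows "vec_norm2 (B *\<^sub>v x) = vec_norm2 (A *\<^sub>v (Q *\<^sub>v x))"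
proof -
  have Bx: "B *\<^sub>v x \<in> carrier_vec k" by (rule mult_mat_vec_carrier[OF carriers(4) x])
  have "Q *\<^sub>v x \<in> krylov k M b" unfolding M_def by (rule mult_vec_in_col_space[OF Q x])
  then have "A *\<^sub>v (Q *\<^sub>v x) = P *\<^sub>v (B *\<^sub>v x)" by (simp add: B_mult_vec[OF x] project_P)
  then show ?thesis using vec_norm2_orthonormal_cols[OF carriers(2) orthonormal(2) Bx] by simp
qed

lemma nonzero_singular_values_B:
  assumes \<sigma>: "\<sigma> \<in> nonzero_singular_values B" and d: "n \<le> d"
  shows "\<sigma> \<in> {singular_value A d .. singular_value A 1}"
proof -
  obtain x where x: "x \<in> carrier_vec k" "vec_norm2 x = 1" "vec_norm2 (B *\<^sub>v x) = \<sigma>"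
    by (rule nonzero_singular_value_attained[OF carriers(4) \<sigma>])
  have Qx: "Q *\<^sub>v x \<in> carrier_vec n" by (rule mult_mat_vec_carrier[OF carriers(1) x(1)])
  have "vec_norm2 (Q *\<^sub>v x) = 1"
    using vec_norm2_orthonormal_cols[OF carriers(1) orthonormal(1) x(1)] x(2) by simp
  then show ?thesis
    using vec_norm2_mult_le_singular_value[OF A Qx] singular_value_le_vec_norm2_mult[OF A d Qx]
      norm_B_mult_vec[OF x(1)] x(3) by simp
qed

text \<open>B^T B equals Q^T A^T P P^T A Q. Applied to the coordinates of M^i b with i < k, both
  projections act as the identity, leaving Q^T M^(i+1) b.\<close>

lemma gram_B_pow:
  assumes "i < k"
  shows "(B\<^sup>T * B) ^\<^sub>m i *\<^sub>v (Q\<^sup>T *\<^sub>v b) = Q\<^sup>T *\<^sub>v (M ^\<^sub>m i *\<^sub>v b)"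
  using assms
proof (induction i)
  case 0
  then show ?case using carriers b by simp
next
  case (Suc i)
  let ?y = "M ^\<^sub>m i *\<^sub>v b" and ?c = "Q\<^sup>T *\<^sub>v b"
  have c: "?c \<in> carrier_vec k" and y: "Q\<^sup>T *\<^sub>v ?y \<in> carrier_vec k" and BB: "B\<^sup>T * B \<in> carrier_mat k k"
    using carriers b krylov_vec by auto
  have "(B\<^sup>T * B) ^\<^sub>m Suc i *\<^sub>v ?c = (B\<^sup>T * B) *\<^sub>v ((B\<^sup>T * B) ^\<^sub>m i *\<^sub>v ?c)"
    unfolding pow_mat_Suc_left[OF BB] by (rule assoc_mult_mat_vec[OF BB pow_carrier_mat[OF BB] c])
  also have "\<dots> = (B\<^sup>T * B) *\<^sub>v (Q\<^sup>T *\<^sub>v ?y)" using Suc by simp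
  also have "\<dots> = B\<^sup>T *\<^sub>v (B *\<^sub>v (Q\<^sup>T *\<^sub>v ?y))"
    by (rule assoc_mult_mat_vec[OF _ carriers(4) y]) (use carriers in auto)
  also have "B *\<^sub>v (Q\<^sup>T *\<^sub>v ?y) = P\<^sup>T *\<^sub>v (A *\<^sub>v ?y)"
    using Suc.prems by (simp add: B_mult_vec[OF y] project_Q)
  also have "B\<^sup>T *\<^sub>v \<dots> = Q\<^sup>T *\<^sub>v (A\<^sup>T *\<^sub>v (P *\<^sub>v (P\<^sup>T *\<^sub>v (A *\<^sub>v ?y))))"
    by (rule BT_mult_vec) (use carriers A krylov_vec[of i] in \<open>auto intro!: mult_mat_vec_carrier\<close>)
  also have "P *\<^sub>v (P\<^sup>T *\<^sub>v (A *\<^sub>v ?y)) = A *\<^sub>v ?y"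
    by (rule project_P) (rule krylov_member[OF carriers(3) b], use Suc.prems in simp)
  also have "A\<^sup>T *\<^sub>v (A *\<^sub>v ?y) = M *\<^sub>v ?y"
    unfolding M_def[unfolded atomize_eq] using A krylov_vec[of i, unfolded M_def] by (simp add: assoc_mult_mat_vec[of _ n m _ n])
  also have "M *\<^sub>v ?y = M ^\<^sub>m Suc i *\<^sub>v b"
    unfolding pow_mat_Suc_left[OF carriers(3)]
    by (rule assoc_mult_mat_vec[OF carriers(3) carriers(5) b, symmetric])
  finally show ?case .
qed

section \<open>Exactness on odd polynomials and error estimates\<close>

abbreviation "approx f \<equiv> P *\<^sub>v (gen_mat_fun f B *\<^sub>v (Q\<^sup>T *\<^sub>v b))"

lemma approx_carrier: "approx f \<in> carrier_vec m"
  using carriers by (intro carrier_vecI) simp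

lemma Qb: "Q\<^sup>T *\<^sub>v b \<in> carrier_vec k"
  using carriers b by auto

lemma approx_add_smult: "approx (\<lambda>z. f z + c * g z) = approx f + c \<cdot>\<^sub>v approx g"
proof -
  have G: "gen_mat_fun h B *\<^sub>v (Q\<^sup>T *\<^sub>v b) \<in> carrier_vec k" for h
    by (rule mult_mat_vec_carrier[OF gen_mat_fun_carrier[OF carriers(4)] Qb])
  show ?thesis
    unfolding gen_mat_fun_add_smult[OF carriers(4) Qb]
    using G carriers(2) by (simp add: mult_add_distrib_mat_vec[of _ m k] mult_mat_vec[of _ m k])
qed

text \<open>Both sides equal A M^i b: on the Krylov side the projections with Q and P drop out
  because i < k.\<close>

lemma exact_odd_monom:
  assumes i: "i < k"
  shows "gen_mat_fun (\<lambda>z. (z\<^sup>2) ^ i * z) A *\<^sub>v b = approx (\<lambda>z. (z\<^sup>2) ^ i * z)"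
proof -
  have y: "Q\<^sup>T *\<^sub>v (M ^\<^sub>m i *\<^sub>v b) \<in> carrier_vec k"
    using carriers krylov_vec by (auto intro!: mult_mat_vec_carrier)
  have "approx (\<lambda>z. (z\<^sup>2) ^ i * z) = P *\<^sub>v (B *\<^sub>v (Q\<^sup>T *\<^sub>v (M ^\<^sub>m i *\<^sub>v b)))"
    by (simp only: gen_mat_fun_odd_monom[OF carriers(4) Qb] gram_B_pow[OF i])
  also have "\<dots> = A *\<^sub>v (M ^\<^sub>m i *\<^sub>v b)"
    by (simp add: B_mult_vec[OF y] project_Q[OF i] project_P krylov_member[OF carriers(3) b i])
  finally show ?thesis by (simp add: gen_mat_fun_odd_monom[OF A b] M_def)
qed

lemma exact_odd_sum:
  assumes "d \<le> k"
  shows "gen_mat_fun (\<lambda>z. \<Sum>i<d. c i * ((z\<^sup>2) ^ i * z)) A *\<^sub>v b = approx (\<lambda>z. \<Sum>i<d. c i * ((z\<^sup>2) ^ i * z))"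
  using assms
proof (induction d)
  case 0
  \<comment> \<open>The zero function is written as g - g, so that linearity and the case i = 0,
    available by k \<ge> 1, cover the empty sum.\<close>
  let ?g = "\<lambda>z::real. (z\<^sup>2) ^ 0 * z"
  have "(\<lambda>z. \<Sum>i<0. c i * ((z\<^sup>2) ^ i * z)) = (\<lambda>z. ?g z + (-1) * ?g z)" by simp
  then show ?case
    using k exact_odd_monom[of 0]
    by (simp only: gen_mat_fun_add_smult[OF A b] approx_add_smult)
next
  case (Suc d)
  then show ?case
    by (simp add: gen_mat_fun_add_smult[OF A b] approx_add_smult exact_odd_monom)
qed

text \<open>With f = e + q for the odd polynomial q(z) = p(z^2) z, both sides of the approximation
  contain the same vector for q, and it cancels.\<close>

lemma error_eq:
  fixes f :: "real \<Rightarrow> real" and p :: "real poly"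
  assumes p: "degree p \<le> k - 1"
  defines "e \<equiv> \<lambda>z. f z - poly p (z\<^sup>2) * z"
  shows "gen_mat_fun f A *\<^sub>v b - approx f = gen_mat_fun e A *\<^sub>v b - approx e"
proof -
  define q where "q z = (\<Sum>i<k. coeff p i * ((z\<^sup>2) ^ i * z))" for z
  have "poly p (z\<^sup>2) * z = q z" for z
  proof -
    have "poly p (z\<^sup>2) = (\<Sum>i<k. coeff p i * (z\<^sup>2) ^ i)"
      unfolding poly_altdef
      by (rule sum.mono_neutral_left) (use p k in \<open>auto simp: coeff_eq_0\<close>)
    then show ?thesis by (simp add: q_def sum_distrib_right mult.assoc)
  qed
  then have f: "f = (\<lambda>z. e z + 1 * q z)" by (simp add: e_def)
  have eq: "gen_mat_fun q A *\<^sub>v b = approx q"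
    unfolding q_def[abs_def] by (rule exact_odd_sum) simp
  have dims: "gen_mat_fun e A *\<^sub>v b \<in> carrier_vec m" "approx e \<in> carrier_vec m" "approx q \<in> carrier_vec m"
    using mult_mat_vec_carrier[OF gen_mat_fun_carrier[OF A] b] approx_carrier by auto
  have fA: "gen_mat_fun f A *\<^sub>v b = gen_mat_fun e A *\<^sub>v b + 1 \<cdot>\<^sub>v approx q"
    by (subst f, subst gen_mat_fun_add_smult[OF A b]) (simp only: eq)
  have fB: "approx f = approx e + 1 \<cdot>\<^sub>v approx q"
    by (subst f, rule approx_add_smult)
  show ?thesis unfolding fA fB using dims
    by (intro eq_vecI) (simp_all del: index_mult_mat_vec)
qed

text \<open>Source of the factor 2: the error function acts once through A and once through B. P
  preserves norms and disappears from the second term.\<close>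

lemma error_le:
  assumes "degree p \<le> k - 1"
  shows "vec_norm2 (gen_mat_fun f A *\<^sub>v b - krylov_approx f A b P Q)
    \<le> vec_norm2 (gen_mat_fun (\<lambda>z. f z - poly p (z\<^sup>2) * z) A *\<^sub>v b)
      + vec_norm2 (gen_mat_fun (\<lambda>z. f z - poly p (z\<^sup>2) * z) B *\<^sub>v (Q\<^sup>T *\<^sub>v b))"
proof -
  let ?e = "\<lambda>z. f z - poly p (z\<^sup>2) * z"
  have G: "gen_mat_fun ?e B *\<^sub>v (Q\<^sup>T *\<^sub>v b) \<in> carrier_vec k"
    by (rule mult_mat_vec_carrier[OF gen_mat_fun_carrier[OF carriers(4)] Qb])
  have "krylov_approx f A b P Q = approx f" by (simp add: krylov_approx_def B_def)
  then show ?thesis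
    using error_eq[OF assms, of f] vec_norm2_orthonormal_cols[OF carriers(2) orthonormal(2) G]
      vec_norm2_triangle_minus[OF mult_mat_vec_carrier[OF gen_mat_fun_carrier[OF A] b] approx_carrier, of ?e ?e]
    by simp
qed

text \<open>Only the singular values of \<open>A\<close> and \<open>B\<close> enter, so a finite maximum replaces the supremum and an
  infinite \<^const>\<open>sup_norm\<close> needs no separate treatment.\<close>

lemma spectral_bound:
  assumes "n \<le> d"
  obtains C where "0 \<le> C" "\<And>z. z \<in> nonzero_singular_values A \<Longrightarrow> \<bar>h z\<bar> \<le> C"
    "\<And>z. z \<in> nonzero_singular_values B \<Longrightarrow> \<bar>h z\<bar> \<le> C"
    "ennreal C \<le> sup_norm {singular_value A d .. singular_value A 1} h"
proof
  let ?S = "nonzero_singular_values A \<union> nonzero_singular_values B"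
  \<comment> \<open>The inserted 0 keeps the maximum defined and nonnegative when there are no
    nonzero singular values; any other value of \<open>C\<close> is attained inside the
    interval.\<close>
  define C where "C = Max (insert 0 ((\<lambda>z. \<bar>h z\<bar>) ` ?S))"
  have fin: "finite (insert 0 ((\<lambda>z. \<bar>h z\<bar>) ` ?S))" by simp
  show "0 \<le> C" "\<And>z. z \<in> nonzero_singular_values A \<Longrightarrow> \<bar>h z\<bar> \<le> C"
    "\<And>z. z \<in> nonzero_singular_values B \<Longrightarrow> \<bar>h z\<bar> \<le> C"
    unfolding C_def by (rule Max_ge[OF fin]; simp)+
  have "?S \<subseteq> {singular_value A d .. singular_value A 1}"
    using nonzero_singular_values_bounds[OF A assms] nonzero_singular_values_B[OF _ assms] by auto
  moreover have "C \<in> insert 0 ((\<lambda>z. \<bar>h z\<bar>) ` ?S)" unfolding C_def by (rule Max_in[OF fin]) simp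
  ultimately show "ennreal C \<le> sup_norm {singular_value A d .. singular_value A 1} h"
    unfolding sup_norm_def by (auto intro!: SUP_upper)
qed

lemma error_bound:
  assumes p: "degree p \<le> k - 1" and d: "n \<le> d"
  shows "ennreal (vec_norm2 (gen_mat_fun f A *\<^sub>v b - krylov_approx f A b P Q))
    \<le> ennreal (2 * vec_norm2 b) *
      sup_norm {singular_value A d .. singular_value A 1} (\<lambda>z. f z - poly p (z\<^sup>2) * z)"
proof -
  let ?e = "\<lambda>z. f z - poly p (z\<^sup>2) * z"
  obtain C where C: "0 \<le> C" "\<And>z. z \<in> nonzero_singular_values A \<Longrightarrow> \<bar>?e z\<bar> \<le> C"
    "\<And>z. z \<in> nonzero_singular_values B \<Longrightarrow> \<bar>?e z\<bar> \<le> C"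
    "ennreal C \<le> sup_norm {singular_value A d .. singular_value A 1} ?e"
    by (rule spectral_bound[OF d, of ?e]) blast
  have "vec_norm2 (gen_mat_fun ?e A *\<^sub>v b) \<le> C * vec_norm2 b"
    using vec_norm2_gen_mat_fun_le[OF A b C(2)] C(1) by simp
  moreover have "vec_norm2 (gen_mat_fun ?e B *\<^sub>v (Q\<^sup>T *\<^sub>v b)) \<le> C * vec_norm2 (Q\<^sup>T *\<^sub>v b)"
    using vec_norm2_gen_mat_fun_le[OF carriers(4) Qb C(3)] C(1) by simp
  moreover have "C * vec_norm2 (Q\<^sup>T *\<^sub>v b) \<le> C * vec_norm2 b"
    by (rule mult_left_mono[OF vec_norm2_transpose_orthonormal_cols[OF carriers(1) orthonormal(1) b] C(1)])
  ultimately have "vec_norm2 (gen_mat_fun f A *\<^sub>v b - krylov_approx f A b P Q) \<le> (2 * vec_norm2 b) * C"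
    using error_le[OF p, of f] by (simp add: mult.commute)
  then have "ennreal (vec_norm2 (gen_mat_fun f A *\<^sub>v b - krylov_approx f A b P Q))
      \<le> ennreal (2 * vec_norm2 b) * ennreal C"
    using C(1) by (simp add: ennreal_mult[symmetric] ennreal_leI)
  also have "\<dots> \<le> ennreal (2 * vec_norm2 b) * sup_norm {singular_value A d .. singular_value A 1} ?e"
    by (rule mult_left_mono[OF C(4)]) simp
  finally show ?thesis .
qed

text \<open>The error function factors as g(z) z. The factor z turns b into A b, and Q^T b into B
  Q^T b, and these two vectors have equal norm.\<close>

lemma error_bound_quotient:
  assumes p: "degree p \<le> k - 1" and d: "n \<le> d" and f0: "f 0 = 0"
  shows "ennreal (vec_norm2 (gen_mat_fun f A *\<^sub>v b - krylov_approx f A b P Q))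
    \<le> ennreal (2 * vec_norm2 (A *\<^sub>v b)) *
      sup_norm {singular_value A d .. singular_value A 1} (\<lambda>z. (if z = 0 then 0 else f z / z) - poly p (z\<^sup>2))"
proof -
  let ?g = "\<lambda>z. (if z = 0 then 0 else f z / z) - poly p (z\<^sup>2)"
  \<comment> \<open>At z = 0 both sides vanish: the left by f 0 = 0, the right by the factor z,
    whatever value the quotient is given there.\<close>
  have e: "(\<lambda>z. f z - poly p (z\<^sup>2) * z) = (\<lambda>z. ?g z * z)"
    using f0 by (auto simp: fun_eq_iff algebra_simps)
  obtain C where C: "0 \<le> C" "\<And>z. z \<in> nonzero_singular_values A \<Longrightarrow> \<bar>?g z\<bar> \<le> C"
    "\<And>z. z \<in> nonzero_singular_values B \<Longrightarrow> \<bar>?g z\<bar> \<le> C"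
    "ennreal C \<le> sup_norm {singular_value A d .. singular_value A 1} ?g"
    by (rule spectral_bound[OF d, of ?g]) blast
  have Ab: "A *\<^sub>v b \<in> carrier_vec m" by (rule mult_mat_vec_carrier[OF A b])
  have "vec_norm2 (gen_mat_fun (\<lambda>z. ?g z * z) A *\<^sub>v b) \<le> C * vec_norm2 (A *\<^sub>v b)"
    using vec_norm2_gen_mat_fun_mult_le[OF A b C(2), where f = "\<lambda>z. z"] C(1)
    by (simp only: gen_mat_fun_ident[OF A b] abs_of_nonneg)
  moreover have "vec_norm2 (gen_mat_fun (\<lambda>z. ?g z * z) B *\<^sub>v (Q\<^sup>T *\<^sub>v b)) \<le> C * vec_norm2 (B *\<^sub>v (Q\<^sup>T *\<^sub>v b))"
    using vec_norm2_gen_mat_fun_mult_le[OF carriers(4) Qb C(3), where f = "\<lambda>z. z"] C(1)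
    by (simp only: gen_mat_fun_ident[OF carriers(4) Qb] abs_of_nonneg)
  moreover have "vec_norm2 (B *\<^sub>v (Q\<^sup>T *\<^sub>v b)) = vec_norm2 (A *\<^sub>v b)"
    by (simp add: norm_B_mult_vec[OF Qb] project_b)
  ultimately have "vec_norm2 (gen_mat_fun f A *\<^sub>v b - krylov_approx f A b P Q) \<le> (2 * vec_norm2 (A *\<^sub>v b)) * C"
    using error_le[OF p, of f] unfolding e by (simp add: mult.commute)
  then have "ennreal (vec_norm2 (gen_mat_fun f A *\<^sub>v b - krylov_approx f A b P Q))
      \<le> ennreal (2 * vec_norm2 (A *\<^sub>v b)) * ennreal C"
    using C(1) by (simp add: ennreal_mult[symmetric] ennreal_leI)
  also have "\<dots> \<le> ennreal (2 * vec_norm2 (A *\<^sub>v b)) * sup_norm {singular_value A d .. singular_value A 1} ?g"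
    by (rule mult_left_mono[OF C(4)]) simp
  finally show ?thesis .
qed

text \<open>Guarantees nonempty intervals, as the existence of a best approximation
  requires.\<close>

lemma singular_value_le: "n \<le> d \<Longrightarrow> singular_value A d \<le> singular_value A 1"
proof (cases "singular_value A d = 0")
  case False
  assume d: "n \<le> d"
  obtain U s V where eq: "compact_svd A = (U, s, V)" and ns: "nonzero_singular_values A = set s"
    by (rule svd_decomp[OF A]) blast
  from False have "s ! (d - 1) \<in> set s" "singular_value A d = s ! (d - 1)"
    by (auto simp: singular_value_def eq split: if_splits)
  then show ?thesis using nonzero_singular_values_bounds(2)[OF A order_refl] ns by simp
qed (use singular_value_nonneg in simp)

end

theorem theorem6p3:
  fixes A P Q :: "real mat" and b :: "real vec" and f :: "real \<Rightarrow> real" and m n k :: nat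
  assumes A: "A \<in> carrier_mat m n" and b: "b \<in> carrier_vec n"
    and k: "k \<ge> 1"
    and f0: "f 0 = 0"
    and Q: "orthonormal_basis_matrix n k Q (krylov k (A\<^sup>T * A) b)"
    and P: "orthonormal_basis_matrix m k P (krylov k (A * A\<^sup>T) (A *\<^sub>v b))"
  shows "(\<exists>\<mu>. is_poly_min (k - 1)
               (\<lambda>p. sup_norm {singular_value A n .. singular_value A 1}
                      (\<lambda>z. f z - poly p (z\<^sup>2) * z)) \<mu> \<and>
             ennreal (vec_norm2 (gen_mat_fun f A *\<^sub>v b - krylov_approx f A b P Q))
               \<le> ennreal (2 * vec_norm2 b) * \<mu>)
       \<and> ((m = n \<and> singular_value A n > 0) \<or> ((\<lambda>z. f z / z) \<longlongrightarrow> 0) (at_right 0) \<longrightarrow>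
          (\<exists>\<mu>. is_poly_min (k - 1)
                 (\<lambda>p. sup_norm {singular_value A (max m n) .. singular_value A 1}
                        (\<lambda>z. (if z = 0 then 0 else f z / z) - poly p (z\<^sup>2))) \<mu> \<and>
               ennreal (vec_norm2 (gen_mat_fun f A *\<^sub>v b - krylov_approx f A b P Q))
                 \<le> ennreal (2 * vec_norm2 (A *\<^sub>v b)) * \<mu>))"
proof -
  interpret golub_kahan A P Q b m n k by unfold_locales fact+
  let ?h = "\<lambda>z. if z = 0 then 0 else f z / z"
  have "\<exists>\<mu>. is_poly_min (k - 1) (\<lambda>p. sup_norm {singular_value A n .. singular_value A 1}
      (\<lambda>z. f z - poly p (z\<^sup>2) * z)) \<mu>"
    by (rule ex_poly_min_interval) (use k f0 singular_value_nonneg singular_value_le in auto)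
  then obtain \<mu> where \<mu>: "is_poly_min (k - 1) (\<lambda>p. sup_norm {singular_value A n .. singular_value A 1}
      (\<lambda>z. f z - poly p (z\<^sup>2) * z)) \<mu>" by blast
  \<comment> \<open>The factor 1 is the constant weight, and the value 0 at z = 0 supplies the
    condition h 0 = 0.\<close>
  have "\<exists>\<mu>. is_poly_min (k - 1) (\<lambda>p. sup_norm {singular_value A (max m n) .. singular_value A 1}
      (\<lambda>z. ?h z - poly p (z\<^sup>2) * 1)) \<mu>"
    by (rule ex_poly_min_interval) (use k singular_value_nonneg singular_value_le in auto)
  then obtain \<nu> where \<nu>: "is_poly_min (k - 1) (\<lambda>p. sup_norm {singular_value A (max m n) .. singular_value A 1}
      (\<lambda>z. ?h z - poly p (z\<^sup>2))) \<nu>" by auto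
  have "ennreal (vec_norm2 (gen_mat_fun f A *\<^sub>v b - krylov_approx f A b P Q)) \<le> ennreal (2 * vec_norm2 b) * \<mu>"
    using \<mu> error_bound[OF _ order_refl] by (auto simp: is_poly_min_def is_arg_min_def)
  moreover have "ennreal (vec_norm2 (gen_mat_fun f A *\<^sub>v b - krylov_approx f A b P Q))
      \<le> ennreal (2 * vec_norm2 (A *\<^sub>v b)) * \<nu>"
    using \<nu> error_bound_quotient[where f = f and d = "max m n", OF _ max.cobounded2 f0] by (auto simp: is_poly_min_def is_arg_min_def)
  ultimately show ?thesis using \<mu> \<nu> by blast
qed

end
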